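(* Let $k\ge1$, $N\in\mathbb{N}_{\ge1}$, and let $\Sigma_i=(\mathbb{R}^{n_i},\mathbb{R}^{m_i},\mathbb{R}^{p_i},\mathcal{U}_i,\mathcal{W}_i,f_i,\sigma_i,r_i,\mathbb{R}^{q_i},h_i)$, $i\in\{1,\dots,N\}$, be stochastic hybrid subsystems with interconnection $\Sigma=\mathcal{I}(\Sigma_1,\dots,\Sigma_N)$. For each $i$ let $\hat\Sigma_i=(\mathbb{R}^{\hat n_i},\mathbb{R}^{\hat m_i},\mathbb{R}^{p_i},\hat{\mathcal{U}}_i,\mathcal{W}_i,\hat f_i,\hat\sigma_i,\hat r_i,\mathbb{R}^{q_i},\hat h_i)$ be a stochastic hybrid subsystem and let $V_i$ be an SSF-M$_k$ function from $\hat\Sigma_i$ to $\Sigma_i$, with corresponding functions $\alpha_i,\eta_i,\rho_{i\mathrm{ext}},\rho_{i\mathrm{int}}$. Assume there exist convex $\mathcal{K}_\infty$ functions $\gamma_i$, constants $\widetilde\lambda_i\in\mathbb{R}_{>0}$ and constants $\delta_{ij}\in\mathbb{R}_{\ge0}$ ($i,j\in\{1,\dots,N\}$, $i\ne j$) such that for all $i\neq j$ and all $s\in\mathbb{R}_{\ge0}$: (a) $\eta_i(s)\ge\widetilde\lambda_i\gamma_i(s)$; (b) $h_{ji}\equiv0\implies\delta_{ij}=0$; (c) $h_{ji}\not\equiv0\implies\rho_{i\mathrm{int}}\big((N-1)^{\max\{k/2,1\}}\alpha_j^{-1}(s)\big)\le\delta_{ij}\gamma_j(s)$. Let $\Lambda,\Delta\in\mathbb{R}^{N\times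 N}$ be given by $\Lambda_{ii}=\widetilde\lambda_i$, $\Delta_{ii}=0$ and, for $i\ne j$, $\Lambda_{ij}=0$, $\Delta_{ij}=\delta_{ij}$. If there exists a vector $\mu\in\mathbb{R}^N_{>0}$ such that $\mu^T(-\Lambda+\Delta)<0$ (component-wise), then $$V(x,\hat x):=\sum_{i=1}^N\mu_iV_i(x_i,\hat x_i),\qquad x=[x_1;\ldots;x_N],\ \hat x=[\hat x_1;\ldots;\hat x_N],$$ is an SSF-M$_k$ function from $\hat\Sigma=\mathcal{I}(\hat\Sigma_1,\dots,\hat\Sigma_N)$ to $\Sigma$.
   Context: A continuous $\gamma:\mathbb{R}_{\ge0}\to\mathbb{R}_{\ge0}$ is of class $\mathcal{K}_\infty$ if it is strictly increasing, $\gamma(0)=0$, and $\gamma(s)\to\infty$ as $s\to\infty$. $\Vert\cdot\Vert$ is the Euclidean norm. $[x_1;\ldots;x_N]$ denotes vertical stacking of vectors or matrices. Noise. $(\Omega,\mathcal{F},\mathbb{P})$ is a probability space with a filtration $\mathbb{F}$ satisfying the usual conditions; $W$ is a $\widetilde p$-dimensional $\mathbb{F}$-Brownian motion and $P=[P^1;\ldots;P^{\widetilde q}]$ a $\widetilde q$-dimensional $\mathbb{F}$-Poisson process with independent components of rates $\lambda_1,\dots,\lambda_{\widetilde q}$, independent of $W$. All systems are driven by the same $W$ and $P$. Stochastic hybrid system. A tuple $\Sigma=(\mathbb{R}^n,\mathbb{R}^m,\mathbb{R}^p,\mathcal{U},\mathcal{W},f,\sigma,r,\mathbb{R}^q,h)$,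 where $\mathbb{R}^n,\mathbb{R}^m,\mathbb{R}^p,\mathbb{R}^q$ are the state, external input, internal input and output spaces; $\mathcal{U}$ (resp. $\mathcal{W}$) is a subset of the set of $\mathbb{F}$-progressively measurable $\mathbb{R}^m$-valued (resp. $\mathbb{R}^p$-valued) processes; $f:\mathbb{R}^n\times\mathbb{R}^m\times\mathbb{R}^p\to\mathbb{R}^n$, $\sigma:\mathbb{R}^n\to\mathbb{R}^{n\times\widetilde p}$, $r:\mathbb{R}^n\to\mathbb{R}^{n\times\widetilde q}$ are globally Lipschitz; $h:\mathbb{R}^n\to\mathbb{R}^q$. It represents $d\xi=f(\xi,\nu,\omega)dt+\sigma(\xi)dW_t+r(\xi)dP_t$, $\zeta=h(\xi)$. A system without internal inputs is a tuple $(\mathbb{R}^n,\mathbb{R}^m,\mathcal{U},f,\sigma,r,\mathbb{R}^q,h)$ with $f:\mathbb{R}^n\times\mathbb{R}^m\to\mathbb{R}^n$. Infinitesimal generator. For $C^2$ $V:\mathbb{R}^n\times\mathbb{R}^{\hat n}\to\mathbb{R}_{\ge0}$, $$\mathcal{L}V(x,\hat x)=[\partial_xV\ \ \partial_{\hat x}V]\begin{bmatrix}f(x,u,w)\\ \hat f(\hat x,\hat u,\hat w)\end{bmatrix}+\frac12\mathrm{Tr}\left(\begin{bmatrix}\sigma(x)\\ \hat\sigma(\hat x)\end{bmatrix}[\sigma^T(x)\ \ \hat\sigma^T(\hat x)]\begin{bmatrix}\partial_{x,x}V&\partial_{x,\hat x}V\\ \partial_{\hat x,x}V&\partial_{\hat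 x,\hat x}V\end{bmatrix}\right)+\sum_{i=1}^{\widetilde q}\lambda_i\big(V(x+r(x)\mathsf{e}_i,\hat x+\hat r(\hat x)\mathsf{e}_i)-V(x,\hat x)\big),$$ with $\mathsf{e}_i$ the $i$th standard unit vector of $\mathbb{R}^{\widetilde q}$ (for systems without internal inputs, $w,\hat w$ are dropped). SSF-M$_k$ function. For $\Sigma,\hat\Sigma$ with the same internal input and output space dimensions, a $C^2$ function $V:\mathbb{R}^n\times\mathbb{R}^{\hat n}\to\mathbb{R}_{\ge0}$ is a stochastic simulation function from $\hat\Sigma$ to $\Sigma$ in the $k$th moment (SSF-M$_k$), $k\ge1$, if it has polynomial growth rate and there are $\mathcal{K}_\infty$ functions $\alpha,\eta,\rho_{\mathrm{ext}},\rho_{\mathrm{int}}$, with $\alpha,\eta$ convex and $\rho_{\mathrm{ext}},\rho_{\mathrm{int}}$ concave, such that for all $x,\hat x$: (i) $\alpha(\Vert h(x)-\hat h(\hat x)\Vert^k)\le V(x,\hat x)$; (ii) $\forall\hat u\in\mathbb{R}^{\hat m}\ \forall\hat w\in\mathbb{R}^p\ \exists u\in\mathbb{R}^m\ \forall w\in\mathbb{R}^p$: $\mathcal{L}V(x,\hat x)\le-\eta(V(x,\hat x))+\rho_{\mathrm{ext}}(\Vert\hat u\Vert^k)+\rho_{\mathrm{int}}(\Vert w-\hat w\Vert^k)$. For systems without internal inputs, (ii) is replaced by: $\forall\hat u\ \exists u$: $\mathcal{L}V(x,\hat x)\le-\eta(V(x,\hat x))+\rho_{\mathrm{ext}}(\Vert\hat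 u\Vert^k)$ (no $\rho_{\mathrm{int}}$). Interconnection. The subsystems have partitioned internal inputs $w_i=[w_{i1};\ldots;w_{i(i-1)};w_{i(i+1)};\ldots;w_{iN}]$, $w_{ij}\in\mathbb{R}^{p_{ij}}$, and outputs $y_i=[y_{i1};\ldots;y_{iN}]$, $y_{ij}\in\mathbb{R}^{q_{ij}}$, with $h_i(x_i)=[h_{i1}(x_i);\ldots;h_{iN}(x_i)]$, where $y_{ij}=h_{ij}(x_i)$, and $p_{ij}=q_{ji}$ for all $i\ne j$. If there is no connection from $\Sigma_i$ to $\Sigma_j$, then $h_{ij}\equiv0$. The abstractions $\hat\Sigma_i$ are partitioned in the same way, with $\hat h_i=[\hat h_{i1};\ldots;\hat h_{iN}]$. The interconnected system $\mathcal{I}(\Sigma_1,\dots,\Sigma_N)=(\mathbb{R}^n,\mathbb{R}^m,\mathcal{U},f,\sigma,r,\mathbb{R}^q,h)$ (without internal inputs) has $n=\sum_in_i$, $m=\sum_im_i$, $q=\sum_iq_{ii}$, and, with $x=[x_1;\ldots;x_N]$, $u=[u_1;\ldots;u_N]$, $f(x,u)=[f_1(x_1,u_1,w_1);\ldots;f_N(x_N,u_N,w_N)]$, $\sigma(x)=[\sigma_1(x_1);\ldots;\sigma_N(x_N)]$, $r(x)=[r_1(x_1);\ldots;r_N(x_N)]$, $h(x)=[h_{11}(x_1);\ldots;h_{NN}(x_N)]$, where $w_{ij}=y_{ji}=h_{ji}(x_j)$ for all $i\neq j$. (The set $\mathcal{U}$ of external input processes plays no role in the SSF-M$_k$ pr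operty.)
   Formalization: The formal theorem additionally assumes that the abstractions respect the absent connections: for i ≠ j, if h_ij ≡ 0 then the corresponding ĥ_ij ≡ 0; without this the claim fails, since δ = 0 would not control the internal input mismatch. *)

theory Defs
  imports
    "HOL-Probability.Probability"
    "Jordan_Normal_Form.Matrix"
begin

hide_type (open) Finite_Cartesian_Product.vec
hide_const (open) Finite_Cartesian_Product.vec Finite_Cartesian_Product.vec_nth
  Finite_Cartesian_Product.mat Finite_Cartesian_Product.row
unbundle no vec_syntax and no inner_syntax

text \<open>
  The dimensions of the subsystems vary with the index of the subsystem, so vectors and matrices
  are those of the Jordan normal form entry: \<open>carrier_vec n\<close> is \<open>\<real>\<^sup>n\<close>. Indices start at 0;
  the subsystems are numbered \<open>0, \<dots>, N - 1\<close>.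
\<close>

type_synonym rvec = "real Matrix.vec"
type_synonym rmat = "real Matrix.mat"

definition euclid_norm :: "rvec \<Rightarrow> real" where
  "euclid_norm x = sqrt (x \<bullet> x)"

text \<open>All matrix norms being equivalent, the Frobenius norm serves to express that a
  matrix-valued map is globally Lipschitz.\<close>

definition frob_norm :: "rmat \<Rightarrow> real" where
  "frob_norm A = sqrt (\<Sum>i<dim_row A. \<Sum>j<dim_col A. (A $$ (i, j))\<^sup>2)"

definition mat_trace :: "rmat \<Rightarrow> real" where
  "mat_trace A = (\<Sum>i<dim_row A. A $$ (i, i))"

subsection \<open>Comparison functions\<close>

text \<open>Functions on \<open>\<real>\<^sub>\<ge>\<^sub>0\<close> are represented by functions on the reals whose values at negative
  arguments are irrelevant.\<close>

definition class_Kinf :: "(real \<Rightarrow> real) \<Rightarrow> bool" where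
  "class_Kinf g \<longleftrightarrow> continuous_on {0..} g \<and> strict_mono_on {0..} g \<and> g 0 = 0 \<and>
     filterlim g at_top at_top"

subsection \<open>Twice continuously differentiable functions on \<open>\<real>\<^sup>n\<close>\<close>

text \<open>\<open>Euclidean_space n\<close> consists of the sequences that vanish from index \<open>n\<close> on;
  \<open>vec n\<close> identifies it with \<open>carrier_vec n\<close>.\<close>

definition continuous_Rn :: "nat \<Rightarrow> (rvec \<Rightarrow> real) \<Rightarrow> bool" where
  "continuous_Rn n F \<longleftrightarrow>
     continuous_map (Euclidean_space n) euclideanreal (\<lambda>a. F (Matrix.vec n a))"

definition partial :: "nat \<Rightarrow> nat \<Rightarrow> (rvec \<Rightarrow> real) \<Rightarrow> rvec \<Rightarrow> real" where
  "partial n i F z = deriv (\<lambda>t. F (z + t \<cdot>\<^sub>v unit_vec n i)) 0"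

definition C1_Rn :: "nat \<Rightarrow> (rvec \<Rightarrow> real) \<Rightarrow> bool" where
  "C1_Rn n F \<longleftrightarrow> continuous_Rn n F \<and>
     (\<forall>i<n. (\<forall>z\<in>carrier_vec n. (\<lambda>t::real. F (z + t \<cdot>\<^sub>v unit_vec n i)) differentiable (at 0)) \<and>
            continuous_Rn n (partial n i F))"

definition C2_Rn :: "nat \<Rightarrow> (rvec \<Rightarrow> real) \<Rightarrow> bool" where
  "C2_Rn n F \<longleftrightarrow> C1_Rn n F \<and> (\<forall>i<n. C1_Rn n (partial n i F))"

definition gradient :: "nat \<Rightarrow> (rvec \<Rightarrow> real) \<Rightarrow> rvec \<Rightarrow> rvec" where
  "gradient n F z = Matrix.vec n (\<lambda>i. partial n i F z)"

definition hessian :: "nat \<Rightarrow> (rvec \<Rightarrow> real) \<Rightarrow> rvec \<Rightarrow> rmat" where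
  "hessian n F z = Matrix.mat n n (\<lambda>(i, j). partial n i (partial n j F) z)"

text \<open>A function of \<open>(x, \<hat>x) \<in> \<real>\<^sup>n \<times> \<real>\<^sup>n\<^sup>'\<close> as a function of the stacked vector \<open>[x; \<hat>x]\<close>. Its
  gradient and Hessian are the block row and the block matrix of the partial derivatives with
  respect to \<open>x\<close> and \<open>\<hat>x\<close>.\<close>

definition on_stacked :: "nat \<Rightarrow> nat \<Rightarrow> (rvec \<Rightarrow> rvec \<Rightarrow> real) \<Rightarrow> rvec \<Rightarrow> real" where
  "on_stacked n n' V z = V (vec_first z n) (vec_last z n')"

subsection \<open>Noise\<close>

text \<open>Only the \<open>\<sigma>\<close>-algebra of \<open>F t\<close> is used, and only for \<open>t \<ge> 0\<close>. Processes are likewise only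
  looked at for times \<open>t \<ge> 0\<close>.\<close>

locale noise = prob_space M
  for M :: "'w measure" +
  fixes F :: "real \<Rightarrow> 'w measure"
    and pt :: nat and W :: "real \<Rightarrow> 'w \<Rightarrow> rvec"
    and qt :: nat and P :: "real \<Rightarrow> 'w \<Rightarrow> rvec" and lam :: "nat \<Rightarrow> real"
  assumes filtration_subalgebra: "\<And>t. 0 \<le> t \<Longrightarrow> subalgebra M (F t)"
    and filtration_mono: "\<And>s t. 0 \<le> s \<Longrightarrow> s \<le> t \<Longrightarrow> sets (F s) \<subseteq> sets (F t)"
    and usual_right_continuous: "\<And>t. 0 \<le> t \<Longrightarrow> sets (F t) = (\<Inter>s\<in>{t<..}. sets (F s))"
    and usual_complete: "\<And>A B. A \<in> null_sets M \<Longrightarrow> B \<subseteq> A \<Longrightarrow> B \<in> sets (F 0)"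
    \<comment> \<open>\<open>W\<close> is an \<open>F\<close>-Brownian motion of dimension \<open>pt\<close>\<close>
    and W_carrier: "\<And>t \<omega>. 0 \<le> t \<Longrightarrow> \<omega> \<in> space M \<Longrightarrow> W t \<omega> \<in> carrier_vec pt"
    and W_adapted: "\<And>t i. 0 \<le> t \<Longrightarrow> i < pt \<Longrightarrow> (\<lambda>\<omega>. W t \<omega> $ i) \<in> borel_measurable (F t)"
    and W_start: "AE \<omega> in M. W 0 \<omega> = 0\<^sub>v pt"
    and W_paths: "\<And>i. i < pt \<Longrightarrow> AE \<omega> in M. continuous_on {0..} (\<lambda>t. W t \<omega> $ i)"
    and W_gaussian: "\<And>s t i. 0 \<le> s \<Longrightarrow> s < t \<Longrightarrow> i < pt \<Longrightarrow>
      distributed M lborel (\<lambda>\<omega>. W t \<omega> $ i - W s \<omega> $ i) (normal_density 0 (sqrt (t - s)))"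
    and W_components: "\<And>s t. 0 \<le> s \<Longrightarrow> s < t \<Longrightarrow>
      indep_vars (\<lambda>_. borel) (\<lambda>i \<omega>. W t \<omega> $ i - W s \<omega> $ i) {..<pt}"
    and W_increments: "\<And>s t. 0 \<le> s \<Longrightarrow> s < t \<Longrightarrow>
      indep_set (sets (F s)) (sets (vimage_algebra (space M)
        (\<lambda>\<omega>. \<lambda>i\<in>{..<pt}. W t \<omega> $ i - W s \<omega> $ i) (Pi\<^sub>M {..<pt} (\<lambda>_. borel))))"
    \<comment> \<open>\<open>P\<close> is an \<open>F\<close>-Poisson process of dimension \<open>qt\<close> with rates \<open>lam\<close>\<close>
    and rates_pos: "\<And>i. i < qt \<Longrightarrow> 0 < lam i"
    and P_carrier: "\<And>t \<omega>. 0 \<le> t \<Longrightarrow> \<omega> \<in> space M \<Longrightarrow> P t \<omega> \<in> carrier_vec qt"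
    and P_adapted: "\<And>t i. 0 \<le> t \<Longrightarrow> i < qt \<Longrightarrow> (\<lambda>\<omega>. P t \<omega> $ i) \<in> borel_measurable (F t)"
    and P_start: "AE \<omega> in M. P 0 \<omega> = 0\<^sub>v qt"
    and P_paths: "\<And>i. i < qt \<Longrightarrow> AE \<omega> in M. mono_on {0..} (\<lambda>t. P t \<omega> $ i) \<and>
      (\<forall>t\<ge>0. P t \<omega> $ i \<in> \<nat> \<and> continuous (at_right t) (\<lambda>s. P s \<omega> $ i))"
    and P_poisson: "\<And>s t i l. 0 \<le> s \<Longrightarrow> s < t \<Longrightarrow> i < qt \<Longrightarrow>
      prob {\<omega>\<in>space M. P t \<omega> $ i - P s \<omega> $ i = real l} = pmf (poisson_pmf (lam i * (t - s))) l"
    and P_increments: "\<And>s t. 0 \<le> s \<Longrightarrow> s < t \<Longrightarrow>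
      indep_set (sets (F s)) (sets (vimage_algebra (space M)
        (\<lambda>\<omega>. \<lambda>i\<in>{..<qt}. P t \<omega> $ i - P s \<omega> $ i) (Pi\<^sub>M {..<qt} (\<lambda>_. borel))))"
    \<comment> \<open>independence of whole processes, viewed as random elements of a product space\<close>
    and P_components:
      "indep_vars (\<lambda>_. Pi\<^sub>M {0..} (\<lambda>_. borel)) (\<lambda>i \<omega>. \<lambda>t\<in>{0..}. P t \<omega> $ i) {..<qt}"
    and W_P_indep:
      "indep_var
        (Pi\<^sub>M ({0..} \<times> {..<pt}) (\<lambda>_. borel)) (\<lambda>\<omega>. \<lambda>(t, i)\<in>{0..} \<times> {..<pt}. W t \<omega> $ i)
        (Pi\<^sub>M ({0..} \<times> {..<qt}) (\<lambda>_. borel)) (\<lambda>\<omega>. \<lambda>(t, i)\<in>{0..} \<times> {..<qt}. P t \<omega> $ i)"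

definition progressively_measurable ::
  "'w measure \<Rightarrow> (real \<Rightarrow> 'w measure) \<Rightarrow> nat \<Rightarrow> (real \<Rightarrow> 'w \<Rightarrow> rvec) \<Rightarrow> bool" where
  "progressively_measurable M F m X \<longleftrightarrow>
     (\<forall>t\<ge>0. \<forall>\<omega>\<in>space M. X t \<omega> \<in> carrier_vec m) \<and>
     (\<forall>t\<ge>0. \<forall>i<m. (\<lambda>(s, \<omega>). X s \<omega> $ i)
        \<in> borel_measurable (restrict_space borel {0..t} \<Otimes>\<^sub>M F t))"

subsection \<open>Stochastic hybrid systems\<close>

record 'w system_base =
  state_dim :: nat
  ext_dim :: nat
  out_dim :: nat
  ext_inputs :: "(real \<Rightarrow> 'w \<Rightarrow> rvec) set"
  diffusion :: "rvec \<Rightarrow> rmat"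
  jump :: "rvec \<Rightarrow> rmat"
  out_map :: "rvec \<Rightarrow> rvec"

record 'w system = "'w system_base" +
  int_dim :: nat
  int_inputs :: "(real \<Rightarrow> 'w \<Rightarrow> rvec) set"
  drift :: "rvec \<Rightarrow> rvec \<Rightarrow> rvec \<Rightarrow> rvec"

text \<open>Systems without internal inputs:\<close>

record 'w closed_system = "'w system_base" +
  closed_drift :: "rvec \<Rightarrow> rvec \<Rightarrow> rvec"

definition stochastic_hybrid_system ::
  "'w measure \<Rightarrow> (real \<Rightarrow> 'w measure) \<Rightarrow> nat \<Rightarrow> nat \<Rightarrow> 'w system \<Rightarrow> bool" where
  "stochastic_hybrid_system M F pt qt S \<longleftrightarrow>
     (\<forall>\<nu>\<in>ext_inputs S. progressively_measurable M F (ext_dim S) \<nu>) \<and>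
     (\<forall>\<omega>\<in>int_inputs S. progressively_measurable M F (int_dim S) \<omega>) \<and>
     (\<forall>x\<in>carrier_vec (state_dim S). \<forall>u\<in>carrier_vec (ext_dim S). \<forall>w\<in>carrier_vec (int_dim S).
        drift S x u w \<in> carrier_vec (state_dim S)) \<and>
     (\<forall>x\<in>carrier_vec (state_dim S).
        diffusion S x \<in> carrier_mat (state_dim S) pt \<and>
        jump S x \<in> carrier_mat (state_dim S) qt \<and>
        out_map S x \<in> carrier_vec (out_dim S)) \<and>
     (\<exists>L. \<forall>x\<in>carrier_vec (state_dim S). \<forall>x'\<in>carrier_vec (state_dim S).
          \<forall>u\<in>carrier_vec (ext_dim S). \<forall>u'\<in>carrier_vec (ext_dim S).
          \<forall>w\<in>carrier_vec (int_dim S). \<forall>w'\<in>carrier_vec (int_dim S).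
        euclid_norm (drift S x u w - drift S x' u' w')
          \<le> L * (euclid_norm (x - x') + euclid_norm (u - u') + euclid_norm (w - w'))) \<and>
     (\<exists>L. \<forall>x\<in>carrier_vec (state_dim S). \<forall>x'\<in>carrier_vec (state_dim S).
        frob_norm (diffusion S x - diffusion S x') \<le> L * euclid_norm (x - x')) \<and>
     (\<exists>L. \<forall>x\<in>carrier_vec (state_dim S). \<forall>x'\<in>carrier_vec (state_dim S).
        frob_norm (jump S x - jump S x') \<le> L * euclid_norm (x - x'))"

text \<open>The arguments \<open>b\<close> and \<open>b'\<close> are the values of the drifts of the two systems at the
  considered states and inputs.\<close>

definition generator ::
  "nat \<Rightarrow> (nat \<Rightarrow> real) \<Rightarrow> ('w, 'c) system_base_scheme \<Rightarrow> ('w, 'd) system_base_scheme \<Rightarrow>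
   (rvec \<Rightarrow> rvec \<Rightarrow> real) \<Rightarrow> rvec \<Rightarrow> rvec \<Rightarrow> rvec \<Rightarrow> rvec \<Rightarrow> real" where
  "generator qt lam S S' V b b' x x' =
     (let n = state_dim S; n' = state_dim S';
          G = on_stacked n n' V; z = x @\<^sub>v x';
          D = diffusion S x @\<^sub>r diffusion S' x'
      in gradient (n + n') G z \<bullet> (b @\<^sub>v b')
         + 1 / 2 * mat_trace (D * transpose_mat D * hessian (n + n') G z)
         + (\<Sum>i<qt. lam i * (V (x + jump S x *\<^sub>v unit_vec qt i) (x' + jump S' x' *\<^sub>v unit_vec qt i)
                             - V x x')))"

subsection \<open>Stochastic simulation functions\<close>

definition polynomial_growth :: "nat \<Rightarrow> nat \<Rightarrow> (rvec \<Rightarrow> rvec \<Rightarrow> real) \<Rightarrow> bool" where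
  "polynomial_growth n n' V \<longleftrightarrow>
     (\<exists>C (d::nat). \<forall>x\<in>carrier_vec n. \<forall>x'\<in>carrier_vec n'.
        \<bar>V x x'\<bar> \<le> C * (1 + euclid_norm (x @\<^sub>v x') ^ d))"

text \<open>The requirements common to systems with and without internal inputs. Here and below, \<open>S'\<close> is
  the abstraction and \<open>V\<close> takes the state of \<open>S\<close> first.\<close>

definition SSF_common ::
  "real \<Rightarrow> ('w, 'c) system_base_scheme \<Rightarrow> ('w, 'd) system_base_scheme \<Rightarrow>
   (rvec \<Rightarrow> rvec \<Rightarrow> real) \<Rightarrow> (real \<Rightarrow> real) \<Rightarrow> (real \<Rightarrow> real) \<Rightarrow> (real \<Rightarrow> real) \<Rightarrow> bool" where
  "SSF_common k S' S V \<alpha> \<eta> \<rho>ext \<longleftrightarrow>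
     out_dim S' = out_dim S \<and>
     C2_Rn (state_dim S + state_dim S') (on_stacked (state_dim S) (state_dim S') V) \<and>
     (\<forall>x\<in>carrier_vec (state_dim S). \<forall>x'\<in>carrier_vec (state_dim S'). 0 \<le> V x x') \<and>
     polynomial_growth (state_dim S) (state_dim S') V \<and>
     class_Kinf \<alpha> \<and> convex_on {0..} \<alpha> \<and>
     class_Kinf \<eta> \<and> convex_on {0..} \<eta> \<and>
     class_Kinf \<rho>ext \<and> concave_on {0..} \<rho>ext \<and>
     (\<forall>x\<in>carrier_vec (state_dim S). \<forall>x'\<in>carrier_vec (state_dim S').
        \<alpha> (euclid_norm (out_map S x - out_map S' x') powr k) \<le> V x x')"

text \<open>\<open>V\<close> is an SSF-M\<open>\<^sub>k\<close> function from \<open>S'\<close> to \<open>S\<close> with corresponding functions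
  \<open>\<alpha>, \<eta>, \<rho>ext, \<rho>int\<close>.\<close>

definition SSF_M_with ::
  "nat \<Rightarrow> (nat \<Rightarrow> real) \<Rightarrow> real \<Rightarrow> 'w system \<Rightarrow> 'w system \<Rightarrow> (rvec \<Rightarrow> rvec \<Rightarrow> real) \<Rightarrow>
   (real \<Rightarrow> real) \<Rightarrow> (real \<Rightarrow> real) \<Rightarrow> (real \<Rightarrow> real) \<Rightarrow> (real \<Rightarrow> real) \<Rightarrow> bool" where
  "SSF_M_with qt lam k S' S V \<alpha> \<eta> \<rho>ext \<rho>int \<longleftrightarrow>
     int_dim S' = int_dim S \<and>
     SSF_common k S' S V \<alpha> \<eta> \<rho>ext \<and>
     class_Kinf \<rho>int \<and> concave_on {0..} \<rho>int \<and>
     (\<forall>x\<in>carrier_vec (state_dim S). \<forall>x'\<in>carrier_vec (state_dim S').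
      \<forall>u'\<in>carrier_vec (ext_dim S'). \<forall>w'\<in>carrier_vec (int_dim S).
      \<exists>u\<in>carrier_vec (ext_dim S). \<forall>w\<in>carrier_vec (int_dim S).
        generator qt lam S S' V (drift S x u w) (drift S' x' u' w') x x'
          \<le> - \<eta> (V x x') + \<rho>ext (euclid_norm u' powr k) + \<rho>int (euclid_norm (w - w') powr k))"

definition SSF_M ::
  "nat \<Rightarrow> (nat \<Rightarrow> real) \<Rightarrow> real \<Rightarrow> 'w system \<Rightarrow> 'w system \<Rightarrow> (rvec \<Rightarrow> rvec \<Rightarrow> real) \<Rightarrow> bool" where
  "SSF_M qt lam k S' S V \<longleftrightarrow> (\<exists>\<alpha> \<eta> \<rho>ext \<rho>int. SSF_M_with qt lam k S' S V \<alpha> \<eta> \<rho>ext \<rho>int)"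

definition closed_SSF_M ::
  "nat \<Rightarrow> (nat \<Rightarrow> real) \<Rightarrow> real \<Rightarrow> 'w closed_system \<Rightarrow> 'w closed_system \<Rightarrow>
   (rvec \<Rightarrow> rvec \<Rightarrow> real) \<Rightarrow> bool" where
  "closed_SSF_M qt lam k S' S V \<longleftrightarrow>
     (\<exists>\<alpha> \<eta> \<rho>ext. SSF_common k S' S V \<alpha> \<eta> \<rho>ext \<and>
       (\<forall>x\<in>carrier_vec (state_dim S). \<forall>x'\<in>carrier_vec (state_dim S').
        \<forall>u'\<in>carrier_vec (ext_dim S'). \<exists>u\<in>carrier_vec (ext_dim S).
          generator qt lam S S' V (closed_drift S x u) (closed_drift S' x' u') x x'
            \<le> - \<eta> (V x x') + \<rho>ext (euclid_norm u' powr k)))"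

subsection \<open>Interconnection\<close>

definition stack_vecs :: "rvec list \<Rightarrow> rvec" where
  "stack_vecs xs = foldr (@\<^sub>v) xs (0\<^sub>v 0)"

definition stack_mats :: "nat \<Rightarrow> rmat list \<Rightarrow> rmat" where
  "stack_mats c As = foldr (@\<^sub>r) As (0\<^sub>m 0 c)"

text \<open>The component \<open>x\<^sub>i\<close> of a stacked vector \<open>x = [x\<^sub>0; x\<^sub>1; \<dots>]\<close>, where \<open>x\<^sub>j\<close> has dimension \<open>d j\<close>:\<close>

definition block :: "(nat \<Rightarrow> nat) \<Rightarrow> nat \<Rightarrow> rvec \<Rightarrow> rvec" where
  "block d i x = Matrix.vec (d i) (\<lambda>l. x $ ((\<Sum>j<i. d j) + l))"

lemma dim_stack_vecs: "dim_vec (stack_vecs xs) = sum_list (map dim_vec xs)"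
  by (induction xs) (auto simp: stack_vecs_def)

lemma stack_vecs_append: "stack_vecs (xs @ ys) = stack_vecs xs @\<^sub>v stack_vecs ys"
proof (induction xs)
  case Nil
  show ?case by (intro eq_vecI) (auto simp: stack_vecs_def)
next
  case (Cons x xs)
  then show ?case by (intro eq_vecI) (auto simp: stack_vecs_def)
qed

lemma block_stack_vecs:
  assumes "\<And>j. j < N \<Longrightarrow> xs j \<in> carrier_vec (d j)" and "i < N"
  shows "block d i (stack_vecs (map xs [0..<N])) = xs i"
proof -
  have split: "[0..<N] = [0..<i] @ i # [Suc i..<N]"
    using assms(2) by (metis less_imp_add_positive upt_add_eq_append upt_conv_Cons zero_le)
  have "sum_list (map (dim_vec \<circ> xs) [0..<i]) = sum_list (map d [0..<i])"
    using assms by (intro arg_cong[where f = sum_list] map_cong) auto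
  then have dims: "dim_vec (stack_vecs (map xs [0..<i])) = (\<Sum>j<i. d j)"
    by (simp add: dim_stack_vecs sum_list_distinct_conv_sum_set atLeast0LessThan)
  have "stack_vecs (map xs [0..<N]) =
      stack_vecs (map xs [0..<i]) @\<^sub>v (xs i @\<^sub>v stack_vecs (map xs [Suc i..<N]))"
    unfolding split map_append stack_vecs_append by (simp add: stack_vecs_def)
  moreover have "dim_vec (xs i) = d i"
    using assms by auto
  ultimately show ?thesis
    using dims by (intro eq_vecI) (auto simp: block_def)
qed

text \<open>\<open>q i j\<close> is the dimension of the part \<open>y\<^sub>i\<^sub>j\<close> of the output of the \<open>i\<close>-th subsystem;
  \<open>out_part q S i j\<close> is the map \<open>h\<^sub>i\<^sub>j\<close>. For \<open>i \<noteq> j\<close>, that this map vanishes identically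
  means that there is no connection from the \<open>i\<close>-th to the \<open>j\<close>-th subsystem.\<close>

definition out_part ::
  "(nat \<Rightarrow> nat \<Rightarrow> nat) \<Rightarrow> (nat \<Rightarrow> 'w system) \<Rightarrow> nat \<Rightarrow> nat \<Rightarrow> rvec \<Rightarrow> rvec" where
  "out_part q S i j x = block (q i) j (out_map (S i) x)"

definition out_part_zero ::
  "(nat \<Rightarrow> nat \<Rightarrow> nat) \<Rightarrow> (nat \<Rightarrow> 'w system) \<Rightarrow> nat \<Rightarrow> nat \<Rightarrow> bool" where
  "out_part_zero q S i j \<longleftrightarrow>
     (\<forall>x\<in>carrier_vec (state_dim (S i)). out_part q S i j x = 0\<^sub>v (q i j))"

text \<open>Dimensions of the partitioned internal inputs and outputs; \<open>p i j\<close> is the dimension of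
  \<open>w\<^sub>i\<^sub>j\<close>.\<close>

definition partitioned ::
  "nat \<Rightarrow> (nat \<Rightarrow> nat \<Rightarrow> nat) \<Rightarrow> (nat \<Rightarrow> nat \<Rightarrow> nat) \<Rightarrow> (nat \<Rightarrow> 'w system) \<Rightarrow> bool" where
  "partitioned N p q S \<longleftrightarrow>
     (\<forall>i<N. int_dim (S i) = (\<Sum>j\<in>{..<N} - {i}. p i j) \<and> out_dim (S i) = (\<Sum>j<N. q i j)) \<and>
     (\<forall>i<N. \<forall>j<N. i \<noteq> j \<longrightarrow> p i j = q j i)"

text \<open>The internal input \<open>[w\<^sub>i\<^sub>j]\<^sub>j\<^sub>\<noteq>\<^sub>i\<close> with \<open>w\<^sub>i\<^sub>j = h\<^sub>j\<^sub>i(x\<^sub>j)\<close>:\<close>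

definition internal_input ::
  "nat \<Rightarrow> (nat \<Rightarrow> nat \<Rightarrow> nat) \<Rightarrow> (nat \<Rightarrow> 'w system) \<Rightarrow> nat \<Rightarrow> rvec \<Rightarrow> rvec" where
  "internal_input N q S i x =
     stack_vecs (map (\<lambda>j. out_part q S j i (block (\<lambda>l. state_dim (S l)) j x))
       (filter (\<lambda>j. j \<noteq> i) [0..<N]))"

text \<open>The external input processes of the interconnection are the stacked processes whose
  components are external input processes of the subsystems. The numbers \<open>pt\<close> and \<open>qt\<close> of columns
  are needed only to stack an empty list of matrices.\<close>

definition interconnection ::
  "nat \<Rightarrow> nat \<Rightarrow> nat \<Rightarrow> (nat \<Rightarrow> nat \<Rightarrow> nat) \<Rightarrow> (nat \<Rightarrow> 'w system) \<Rightarrow> 'w closed_system" where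
  "interconnection pt qt N q S =
    (let n = (\<lambda>i. state_dim (S i)); m = (\<lambda>i. ext_dim (S i)) in
    \<lparr> state_dim = (\<Sum>i<N. n i),
      ext_dim = (\<Sum>i<N. m i),
      out_dim = (\<Sum>i<N. q i i),
      ext_inputs = {\<lambda>t \<omega>. stack_vecs (map (\<lambda>i. \<nu> i t \<omega>) [0..<N]) |\<nu>. \<forall>i<N. \<nu> i \<in> ext_inputs (S i)},
      diffusion = (\<lambda>x. stack_mats pt (map (\<lambda>i. diffusion (S i) (block n i x)) [0..<N])),
      jump = (\<lambda>x. stack_mats qt (map (\<lambda>i. jump (S i) (block n i x)) [0..<N])),
      out_map = (\<lambda>x. stack_vecs (map (\<lambda>i. out_part q S i i (block n i x)) [0..<N])),
      closed_drift = (\<lambda>x u. stack_vecs (map (\<lambda>i.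
        drift (S i) (block n i x) (block m i u) (internal_input N q S i x)) [0..<N])) \<rparr>)"

end

theory Submission
  imports Defs
begin

text \<open>
The function \<open>V\<close> is a positive combination of functions \<open>V\<^sub>i\<close>, each of which reads only the coordinates
of the stacked state \<open>[x; \<hat>x]\<close> that belong to the \<open>i\<close>-th pair of subsystems. The generator is linear in
\<open>V\<close>, and on a function of selected coordinates it acts as the generator of the selected subsystem:
derivatives in all other directions vanish, and the drift, the rows of the diffusion and the jumps of
the interconnection, read in the selected coordinates, are those of the subsystem. Hence
\<open>\<L>V = \<Sum>\<^sub>i \<mu>\<^sub>i \<L>V\<^sub>i\<close> (\<open>generator_block_sum\<close>), where the \<open>i\<close>-th summand carries the internal inputs that the
interconnection generates.

Given the states and the abstract external inputs, the abstract internal inputs are determined, so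
every subsystem offers an external input \<open>u\<^sub>i\<close> for which its own estimate holds for all concrete internal
inputs; the \<open>u\<^sub>i\<close> are stacked. The mismatch of the internal inputs of the \<open>i\<close>-th pair is a stack of
\<open>N - 1\<close> output mismatches. The largest of them controls its norm up to the factor
\<open>(N - 1)\<^sup>1\<^sup>/\<^sup>2\<close>, hence the \<open>k\<close>-th power up to \<open>(N - 1)\<close> to the power \<open>k / 2\<close>, and
the output mismatch of the \<open>j\<close>-th pair is controlled by \<open>\<alpha>\<^sub>j\<^sup>-\<^sup>1(V\<^sub>j)\<close>. So the internal gain of
the \<open>i\<close>-th pair is at most \<open>\<Sum>\<^sub>j \<delta>\<^sub>i\<^sub>j \<gamma>\<^sub>j(V\<^sub>j)\<close> (\<open>internal_gain_le\<close>). Summing up with the weights \<open>\<mu>\<^sub>i\<close> and collecting the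
coefficients of each \<open>\<gamma>\<^sub>j(V\<^sub>j)\<close> (\<open>small_gain_sum_le\<close>) leaves \<open>\<mu>\<^sup>T(- \<Lambda> + \<Delta>)\<close> applied to these values, which
is \<open>- \<Sum>\<^sub>j \<epsilon>\<^sub>j \<gamma>\<^sub>j(V\<^sub>j)\<close> with all \<open>\<epsilon>\<^sub>j\<close> positive.

It remains to find the comparison functions of \<open>V\<close>. The external gain is the weighted sum of the
external gains. The decay rate and the output bound have to be convex and to lie below finitely many convex
functions of class \<open>\<K>\<^sub>\<infinity>\<close>, whose minimum need not be convex. Inversion turns convex functions of class
\<open>\<K>\<^sub>\<infinity>\<close> into concave ones and reverses the order; concave functions can be added; and the inverse of the sum
is convex and lies below all given functions (\<open>convex_class_Kinf_lower_bound\<close>).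
\<close>

section \<open>Comparison functions\<close>

lemma class_Kinf_less: "class_Kinf g \<Longrightarrow> 0 \<le> x \<Longrightarrow> 0 \<le> y \<Longrightarrow> g x < g y \<longleftrightarrow> x < y"
  unfolding class_Kinf_def
  by (metis atLeast_iff linorder_neqE_linordered_idom order_less_asym order_less_irrefl strict_mono_onD)

lemma class_Kinf_le: "class_Kinf g \<Longrightarrow> 0 \<le> x \<Longrightarrow> 0 \<le> y \<Longrightarrow> g x \<le> g y \<longleftrightarrow> x \<le> y"
  using class_Kinf_less[of g y x] by linarith

lemma class_Kinf_zero [simp]: "class_Kinf g \<Longrightarrow> g 0 = 0"
  by (simp add: class_Kinf_def)

lemma class_Kinf_nonneg: "class_Kinf g \<Longrightarrow> 0 \<le> x \<Longrightarrow> 0 \<le> g x"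
  using class_Kinf_le[of g 0 x] by simp

lemma class_Kinf_image:
  assumes g: "class_Kinf g"
  shows "g ` {0..} = {0..}"
proof (intro equalityI subsetI)
  fix y assume "y \<in> g ` {0..}"
  then show "y \<in> {0..}" using class_Kinf_nonneg[OF g] by auto
next
  fix y :: real assume y: "y \<in> {0..}"
  have "eventually (\<lambda>x. y \<le> g x) at_top"
    using g by (auto simp: class_Kinf_def filterlim_at_top)
  then obtain b where b: "\<And>x. b \<le> x \<Longrightarrow> y \<le> g x"
    by (auto simp: eventually_at_top_linorder)
  have "continuous_on {0..max b 0} g"
    using g by (auto simp: class_Kinf_def intro: continuous_on_subset)
  then obtain x where "0 \<le> x" "g x = y"
    using IVT'[of g 0 y "max b 0"] b[of "max b 0"] y g by auto
  then show "y \<in> g ` {0..}" by auto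
qed

lemma class_Kinf_inv_into:
  assumes g: "class_Kinf g" and s: "0 \<le> s"
  shows "0 \<le> inv_into {0..} g s" "g (inv_into {0..} g s) = s"
  using inv_into_into[of s g "{0..}"] f_inv_into_f[of s g "{0..}"] class_Kinf_image[OF g] s by auto

text \<open>The inverse is characterised by a Galois connection, which is the form in which it is used below.\<close>

lemma class_Kinf_le_inv_into:
  assumes g: "class_Kinf g" and "0 \<le> s" "0 \<le> x"
  shows "x \<le> inv_into {0..} g s \<longleftrightarrow> g x \<le> s"
  using class_Kinf_inv_into[OF g, of s] class_Kinf_le[OF g, of x "inv_into {0..} g s"] assms by simp

text \<open>Continuity of the inverse at \<open>s = g a\<close>: by monotonicity, values strictly between
\<open>g (a - e)\<close> and \<open>g (a + e)\<close> have their preimage within \<open>e\<close> of \<open>a\<close>. If \<open>a < e\<close>, the lower bound is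
automatic, since preimages are nonnegative.\<close>

lemma class_Kinf_inverse:
  assumes g: "class_Kinf g"
  shows "class_Kinf (inv_into {0..} g)"
proof -
  let ?h = "inv_into {0..} g"
  note inv = class_Kinf_inv_into[OF g]
  have less: "?h s < ?h t" if "0 \<le> s" "s < t" for s t
    using that inv[of s] inv[of t] class_Kinf_less[OF g, of "?h s" "?h t"] by simp
  have "continuous_on {0..} ?h"
    unfolding continuous_on_iff
  proof (intro ballI allI impI)
    fix s e :: real assume s: "s \<in> {0..}" and e: "0 < e"
    define a where "a = ?h s"
    have a: "0 \<le> a" "g a = s" using inv[of s] s by (auto simp: a_def)
    define d1 where "d1 = (if a < e then 1 else s - g (a - e))"
    have d1: "0 < d1"
      using class_Kinf_less[OF g, of "a - e" a] a e by (auto simp: d1_def)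
    define d where "d = min d1 (g (a + e) - s)"
    have d: "0 < d"
      using d1 class_Kinf_less[OF g, of a "a + e"] a e by (auto simp: d_def)
    have "\<bar>?h t - a\<bar> < e" if t: "0 \<le> t" "\<bar>t - s\<bar> < d" for t
    proof -
      have "g (?h t) < g (a + e)" using t inv[of t] by (auto simp: d_def)
      then have up: "?h t < a + e"
        using class_Kinf_less[OF g, of "?h t" "a + e"] inv[of t] t a e by simp
      have low: "a - e < ?h t"
      proof (cases "a < e")
        case True
        then show ?thesis using inv[of t] t by simp
      next
        case False
        then have "g (a - e) < g (?h t)" using t inv[of t] by (auto simp: d_def d1_def)
        then show ?thesis
          using class_Kinf_less[OF g, of "a - e" "?h t"] inv[of t] t False by simp
      qed
      show ?thesis using up low by (simp add: abs_less_iff)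
    qed
    then show "\<exists>d>0. \<forall>t\<in>{0..}. dist t s < d \<longrightarrow> dist (?h t) (?h s) < e"
      using d by (auto simp: dist_real_def a_def)
  qed
  moreover have "strict_mono_on {0..} ?h"
    using less by (auto simp: strict_mono_on_def)
  moreover have "?h 0 = 0"
    using inv[of 0] class_Kinf_le[OF g, of "?h 0" 0] g by simp
  moreover have "filterlim ?h at_top at_top"
    unfolding filterlim_at_top_ge[where c = 0] eventually_at_top_linorder
  proof (intro allI impI)
    fix Z :: real assume Z: "0 \<le> Z"
    have "Z \<le> ?h t" if "g Z \<le> t" for t
      using class_Kinf_le_inv_into[OF g, of t Z] class_Kinf_nonneg[OF g Z] that Z by simp
    then show "\<exists>T. \<forall>t\<ge>T. Z \<le> ?h t" by blast
  qed
  ultimately show ?thesis by (simp add: class_Kinf_def)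
qed

lemma convex_inverse_concave:
  assumes g: "class_Kinf g" "convex_on {0..} g"
  shows "concave_on {0..} (inv_into {0..} g)"
  unfolding concave_on_iff
proof (intro conjI ballI allI impI)
  fix x y u v :: real assume xy: "x \<in> {0..}" "y \<in> {0..}" and uv: "0 \<le> u" "0 \<le> v" "u + v = 1"
  let ?h = "inv_into {0..} g"
  note inv = class_Kinf_inv_into[OF g(1)]
  have "g (u *\<^sub>R ?h x + v *\<^sub>R ?h y) \<le> u * g (?h x) + v * g (?h y)"
    using g(2)[unfolded convex_on_def, THEN conjunct2, rule_format, of "?h x" "?h y" u v]
      xy uv inv[of x] inv[of y] by simp
  also have "\<dots> = u * x + v * y" using inv[of x] inv[of y] xy by simp
  finally show "u * ?h x + v * ?h y \<le> ?h (u *\<^sub>R x + v *\<^sub>R y)"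
    using class_Kinf_le_inv_into[OF g(1), of "u * x + v * y" "u * ?h x + v * ?h y"]
      inv[of x] inv[of y] xy uv by simp
qed auto

lemma concave_inverse_convex:
  assumes g: "class_Kinf g" "concave_on {0..} g"
  shows "convex_on {0..} (inv_into {0..} g)"
  unfolding convex_on_def
proof (intro conjI ballI allI impI)
  fix x y u v :: real assume xy: "x \<in> {0..}" "y \<in> {0..}" and uv: "0 \<le> u" "0 \<le> v" "u + v = 1"
  let ?h = "inv_into {0..} g"
  note inv = class_Kinf_inv_into[OF g(1)]
  have "u * x + v * y = u * g (?h x) + v * g (?h y)" using inv[of x] inv[of y] xy by simp
  also have "\<dots> \<le> g (u * ?h x + v * ?h y)"
    using g(2)[unfolded concave_on_iff, THEN conjunct2, rule_format, of "?h x" "?h y" u v]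
      xy uv inv[of x] inv[of y] by simp
  finally have "g (?h (u * x + v * y)) \<le> g (u * ?h x + v * ?h y)"
    using inv[of "u * x + v * y"] xy uv by simp
  then show "?h (u *\<^sub>R x + v *\<^sub>R y) \<le> u * ?h x + v * ?h y"
    using class_Kinf_le[OF g(1), of "?h (u * x + v * y)" "u * ?h x + v * ?h y"]
      inv[of "u * x + v * y"] inv[of x] inv[of y] xy uv by simp
qed auto

lemma class_Kinf_rescale:
  assumes g: "class_Kinf g" and a: "0 < a" and b: "0 < b"
  shows "class_Kinf (\<lambda>s. a * g (b * s))"
  unfolding class_Kinf_def
proof (intro conjI)
  have "continuous_on {0..} g" using g by (simp add: class_Kinf_def)
  then have "continuous_on {0..} (\<lambda>s. g (b * s))"
    by (rule continuous_on_compose2) (use b in \<open>auto intro!: continuous_intros\<close>)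
  then show "continuous_on {0..} (\<lambda>s. a * g (b * s))"
    by (rule continuous_on_mult_left)
  show "strict_mono_on {0..} (\<lambda>s. a * g (b * s))"
    using class_Kinf_less[OF g] a b by (auto simp: strict_mono_on_def)
  show "a * g (b * 0) = 0" using g by simp
  have "filterlim (\<lambda>s. b * s) at_top at_top"
    using filterlim_tendsto_pos_mult_at_top[OF tendsto_const b filterlim_ident] .
  then have "filterlim (\<lambda>s. g (b * s)) at_top at_top"
    using g filterlim_compose[of g at_top at_top] by (auto simp: class_Kinf_def)
  then show "filterlim (\<lambda>s. a * g (b * s)) at_top at_top"
    using filterlim_tendsto_pos_mult_at_top[OF tendsto_const a] by blast
qed

lemma convex_on_rescale:
  fixes g :: "real \<Rightarrow> real"
  assumes g: "convex_on {0..} g" and a: "0 \<le> a" and b: "0 \<le> b"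
  shows "convex_on {0..} (\<lambda>s. a * g (b * s))"
proof (intro convex_on_cmul[OF a])
  show "convex_on {0..} (\<lambda>s. g (b * s))"
    unfolding convex_on_def
  proof (intro conjI ballI allI impI)
    fix x y u v :: real assume xy: "x \<in> {0..}" "y \<in> {0..}" and uv: "0 \<le> u" "0 \<le> v" "u + v = 1"
    have "g (u *\<^sub>R (b * x) + v *\<^sub>R (b * y)) \<le> u * g (b * x) + v * g (b * y)"
      using g xy uv b unfolding convex_on_def by (auto simp: mult_nonneg_nonneg)
    then show "g (b * (u *\<^sub>R x + v *\<^sub>R y)) \<le> u * g (b * x) + v * g (b * y)"
      by (simp add: algebra_simps)
  qed auto
qed

lemma class_Kinf_sum:
  assumes I: "finite I" "I \<noteq> {}" and g: "\<And>i. i \<in> I \<Longrightarrow> class_Kinf (g i)"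
  shows "class_Kinf (\<lambda>s. \<Sum>i\<in>I. g i s)"
  unfolding class_Kinf_def
proof (intro conjI)
  show "continuous_on {0..} (\<lambda>s. \<Sum>i\<in>I. g i s)"
    using g by (intro continuous_on_sum) (auto simp: class_Kinf_def)
  show "strict_mono_on {0..} (\<lambda>s. \<Sum>i\<in>I. g i s)"
    using I class_Kinf_less[OF g] by (auto simp: strict_mono_on_def intro!: sum_strict_mono)
  show "(\<Sum>i\<in>I. g i 0) = 0" using g by (simp add: class_Kinf_def)
  obtain j where j: "j \<in> I" using I by auto
  have "g j s \<le> (\<Sum>i\<in>I. g i s)" if "0 \<le> s" for s
    using member_le_sum[OF j, of "\<lambda>i. g i s"] class_Kinf_nonneg[OF g that] I by auto
  then have "eventually (\<lambda>s. g j s \<le> (\<Sum>i\<in>I. g i s)) at_top"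
    by (auto simp: eventually_at_top_linorder)
  moreover have "filterlim (g j) at_top at_top" using g[OF j] by (simp add: class_Kinf_def)
  ultimately show "filterlim (\<lambda>s. \<Sum>i\<in>I. g i s) at_top at_top"
    by (rule filterlim_at_top_mono[rotated])
qed

lemma concave_on_sum_nonneg:
  assumes "finite I" "\<And>i. i \<in> I \<Longrightarrow> concave_on {0..} (g i)"
  shows "concave_on {0..} (\<lambda>s::real. \<Sum>i\<in>I. g i s)"
  using assms
  by (induction I rule: finite_induct) (auto simp: concave_on_const intro: concave_on_add)

text \<open>The minimum of convex functions is in general not convex. The sum of the concave inverses lies
above each of them, so its inverse lies below every \<open>g i\<close>, and it is convex again.\<close>

lemma convex_class_Kinf_lower_bound:
  fixes g :: "'i \<Rightarrow> real \<Rightarrow> real"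
  assumes I: "finite I" "I \<noteq> {}"
    and g: "\<And>i. i \<in> I \<Longrightarrow> class_Kinf (g i)" "\<And>i. i \<in> I \<Longrightarrow> convex_on {0..} (g i)"
  shows "\<exists>\<beta>. class_Kinf \<beta> \<and> convex_on {0..} \<beta> \<and> (\<forall>i\<in>I. \<forall>s\<ge>0. \<beta> s \<le> g i s)"
proof -
  let ?\<theta> = "\<lambda>s. \<Sum>i\<in>I. inv_into {0..} (g i) s"
  have \<theta>: "class_Kinf ?\<theta>" "concave_on {0..} ?\<theta>"
    using I g
    by (auto intro!: class_Kinf_sum concave_on_sum_nonneg class_Kinf_inverse convex_inverse_concave)
  let ?\<beta> = "inv_into {0..} ?\<theta>"
  have "?\<beta> s \<le> g i s" if i: "i \<in> I" and s: "0 \<le> s" for i s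
  proof -
    note inv = class_Kinf_inv_into[OF \<theta>(1) s]
    note inv_i = class_Kinf_inv_into[OF g(1)[OF i] inv(1)]
    have "inv_into {0..} (g i) (?\<beta> s) \<le> ?\<theta> (?\<beta> s)"
      using member_le_sum[OF i, of "\<lambda>i. inv_into {0..} (g i) (?\<beta> s)"]
        class_Kinf_inv_into(1)[OF g(1) inv(1)] I
      by auto
    then have "inv_into {0..} (g i) (?\<beta> s) \<le> s" using inv by simp
    then have "g i (inv_into {0..} (g i) (?\<beta> s)) \<le> g i s"
      using class_Kinf_le[OF g(1)[OF i] inv_i(1) s] by blast
    then show ?thesis by (simp only: inv_i(2))
  qed
  then show ?thesis
    using class_Kinf_inverse[OF \<theta>(1)] concave_inverse_convex[OF \<theta>] by blast
qed

text \<open>This yields the output bound of the interconnection, with \<open>t\<close> a power of the mismatch of the stacked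
outputs, which is controlled by the largest of the mismatches \<open>r\<close> of the subsystems.\<close>

lemma convex_common_lower_bound:
  fixes N :: nat
  assumes N: "N \<ge> 1" and \<alpha>: "\<And>i. i < N \<Longrightarrow> class_Kinf (\<alpha> i)" "\<And>i. i < N \<Longrightarrow> convex_on {0..} (\<alpha> i)"
    and \<mu>: "\<And>i. i < N \<Longrightarrow> 0 < \<mu> i" and c: "0 < c"
  obtains \<beta> where "class_Kinf \<beta>" "convex_on {0..} \<beta>"
    "\<And>i t r. i < N \<Longrightarrow> 0 \<le> t \<Longrightarrow> 0 \<le> r \<Longrightarrow> t \<le> c * r \<Longrightarrow> \<beta> t \<le> \<mu> i * \<alpha> i r"
proof -
  define g where "g = (\<lambda>i s. \<mu> i * \<alpha> i (1 / c * s))"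
  have g: "class_Kinf (g i)" "convex_on {0..} (g i)" if "i \<in> {..<N}" for i
  proof -
    have i: "i < N" using that by simp
    have pos: "0 < 1 / c" using c by simp
    show "class_Kinf (g i)"
      unfolding g_def by (rule class_Kinf_rescale[OF \<alpha>(1)[OF i] \<mu>[OF i] pos])
    show "convex_on {0..} (g i)"
      unfolding g_def
      by (rule convex_on_rescale[OF \<alpha>(2)[OF i] less_imp_le[OF \<mu>[OF i]] less_imp_le[OF pos]])
  qed
  have ne: "{..<N} \<noteq> {}" using N by (auto simp: lessThan_empty_iff)
  obtain \<beta> where \<beta>: "class_Kinf \<beta>" "convex_on {0..} \<beta>"
      and le: "\<forall>i\<in>{..<N}. \<forall>s\<ge>0. \<beta> s \<le> g i s"
    using convex_class_Kinf_lower_bound[of "{..<N}" g, OF finite_lessThan ne g] by blast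
  have "\<beta> t \<le> \<mu> i * \<alpha> i r" if "i < N" "0 \<le> t" "0 \<le> r" "t \<le> c * r" for i t r
  proof -
    have "\<beta> t \<le> \<beta> (c * r)" using class_Kinf_le[OF \<beta>(1), of t "c * r"] that c by simp
    also have "\<dots> \<le> \<mu> i * \<alpha> i (1 / c * (c * r))"
      using le that c by (simp add: g_def del: times_divide_eq_left)
    finally show ?thesis using c by simp
  qed
  then show ?thesis using that \<beta> by blast
qed

lemma concave_class_Kinf_weighted_sum:
  fixes N :: nat
  assumes N: "N \<ge> 1" and \<rho>: "\<And>i. i < N \<Longrightarrow> class_Kinf (\<rho> i)" "\<And>i. i < N \<Longrightarrow> concave_on {0..} (\<rho> i)"
    and \<mu>: "\<And>i. i < N \<Longrightarrow> 0 < \<mu> i"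
  shows "class_Kinf (\<lambda>s. \<Sum>i<N. \<mu> i * \<rho> i s)" "concave_on {0..} (\<lambda>s. \<Sum>i<N. \<mu> i * \<rho> i s)"
proof -
  have "class_Kinf (\<lambda>s. \<mu> i * \<rho> i s)" if "i < N" for i
    using class_Kinf_rescale[OF \<rho>(1)[OF that] \<mu>[OF that], of 1] by simp
  moreover have "{..<N} \<noteq> {}" using N by (auto simp: lessThan_empty_iff)
  ultimately show "class_Kinf (\<lambda>s. \<Sum>i<N. \<mu> i * \<rho> i s)"
    by (intro class_Kinf_sum) auto
  show "concave_on {0..} (\<lambda>s. \<Sum>i<N. \<mu> i * \<rho> i s)"
    by (intro concave_on_sum_nonneg concave_on_cmul) (auto simp: \<rho> less_imp_le[OF \<mu>])
qed

text \<open>Some summand of \<open>\<Sum>i<N. \<mu> i * a i\<close> is at least the \<open>N\<close>-th part of the sum. A convex function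
below all \<open>\<epsilon> i * \<Gamma> i (s / (N * \<mu> i))\<close> is therefore a lower bound in terms of that summand alone.\<close>

lemma convex_rate_of_weighted_sum:
  fixes N :: nat
  assumes N: "N \<ge> 1" and \<Gamma>: "\<And>i. i < N \<Longrightarrow> class_Kinf (\<Gamma> i)" "\<And>i. i < N \<Longrightarrow> convex_on {0..} (\<Gamma> i)"
    and \<epsilon>: "\<And>i. i < N \<Longrightarrow> 0 < \<epsilon> i" and \<mu>: "\<And>i. i < N \<Longrightarrow> 0 < \<mu> i"
  shows "\<exists>\<beta>. class_Kinf \<beta> \<and> convex_on {0..} \<beta> \<and>
    (\<forall>a. (\<forall>i<N. 0 \<le> a i) \<longrightarrow> \<beta> (\<Sum>i<N. \<mu> i * a i) \<le> (\<Sum>i<N. \<epsilon> i * \<Gamma> i (a i)))"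
proof -
  define g where "g = (\<lambda>i s. \<epsilon> i * \<Gamma> i (1 / (real N * \<mu> i) * s))"
  have g: "class_Kinf (g i)" "convex_on {0..} (g i)" if "i \<in> {..<N}" for i
  proof -
    have i: "i < N" using that by simp
    have pos: "0 < 1 / (real N * \<mu> i)" using \<mu>[OF i] N by simp
    show "class_Kinf (g i)"
      unfolding g_def by (rule class_Kinf_rescale[OF \<Gamma>(1)[OF i] \<epsilon>[OF i] pos])
    show "convex_on {0..} (g i)"
      unfolding g_def
      by (rule convex_on_rescale[OF \<Gamma>(2)[OF i] less_imp_le[OF \<epsilon>[OF i]] less_imp_le[OF pos]])
  qed
  have ne: "{..<N} \<noteq> {}" using N by (auto simp: lessThan_empty_iff)
  obtain \<beta> where \<beta>: "class_Kinf \<beta>" "convex_on {0..} \<beta>"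
      and le: "\<forall>i\<in>{..<N}. \<forall>s\<ge>0. \<beta> s \<le> g i s"
    using convex_class_Kinf_lower_bound[of "{..<N}" g, OF finite_lessThan ne g] by blast
  have "\<beta> (\<Sum>i<N. \<mu> i * a i) \<le> (\<Sum>i<N. \<epsilon> i * \<Gamma> i (a i))" if a: "\<And>i. i < N \<Longrightarrow> 0 \<le> a i" for a
  proof -
    let ?s = "\<Sum>i<N. \<mu> i * a i"
    have s: "0 \<le> ?s" by (intro sum_nonneg mult_nonneg_nonneg less_imp_le[OF \<mu>] a) auto
    have "\<exists>j<N. ?s \<le> real N * (\<mu> j * a j)"
    proof (rule ccontr)
      assume "\<not> (\<exists>j<N. ?s \<le> real N * (\<mu> j * a j))"
      then have "\<mu> j * a j < ?s / real N" if "j < N" for j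
        using that N by (auto simp: field_simps not_le)
      then have "?s < (\<Sum>j<N. ?s / real N)" using ne by (intro sum_strict_mono) auto
      then show False using N by simp
    qed
    then obtain j where j: "j < N" "?s \<le> real N * (\<mu> j * a j)" by blast
    have "\<beta> ?s \<le> \<epsilon> j * \<Gamma> j (1 / (real N * \<mu> j) * ?s)"
      using le j(1) s by (simp add: g_def)
    also have "\<dots> \<le> \<epsilon> j * \<Gamma> j (a j)"
    proof (intro mult_left_mono)
      have "1 / (real N * \<mu> j) * ?s \<le> a j"
        using j N \<mu>[OF j(1)] by (simp add: field_simps)
      then show "\<Gamma> j (1 / (real N * \<mu> j) * ?s) \<le> \<Gamma> j (a j)"
        using class_Kinf_le[OF \<Gamma>(1)[OF j(1)], of "1 / (real N * \<mu> j) * ?s" "a j"] s \<mu>[OF j(1)] a[OF j(1)]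
        by simp
    qed (use \<epsilon>[OF j(1)] in simp)
    also have "\<dots> \<le> (\<Sum>i<N. \<epsilon> i * \<Gamma> i (a i))"
      using j(1) class_Kinf_nonneg[OF \<Gamma>(1)] a \<epsilon>
      by (intro member_le_sum) (auto intro!: mult_nonneg_nonneg simp: less_imp_le)
    finally show ?thesis .
  qed
  then show ?thesis using \<beta> by blast
qed

section \<open>Twice continuously differentiable functions of selected coordinates\<close>

text \<open>The points at which a partial derivative probes a function always lie in \<open>carrier_vec n\<close>, whatever \<open>z\<close>
is, because a sum of vectors takes its dimension from the second summand. So the equality holds everywhere,
and it can be applied below further derivatives.\<close>

lemma partial_cong:
  assumes "\<And>z. z \<in> carrier_vec n \<Longrightarrow> F z = G z"
  shows "partial n i F = partial n i G"
proof
  fix z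
  have "F (z + t \<cdot>\<^sub>v unit_vec n i) = G (z + t \<cdot>\<^sub>v unit_vec n i)" for t
    by (rule assms) (auto intro!: carrier_vecI)
  then show "partial n i F z = partial n i G z" by (simp add: partial_def)
qed

lemma continuous_Rn_cong:
  assumes "\<And>z. z \<in> carrier_vec n \<Longrightarrow> F z = G z"
  shows "continuous_Rn n F \<longleftrightarrow> continuous_Rn n G"
  using assms by (simp add: continuous_Rn_def)

lemma C1_Rn_cong:
  assumes "\<And>z. z \<in> carrier_vec n \<Longrightarrow> F z = G z"
  shows "C1_Rn n F \<longleftrightarrow> C1_Rn n G"
proof -
  have "F (z + t \<cdot>\<^sub>v unit_vec n i) = G (z + t \<cdot>\<^sub>v unit_vec n i)" for z t i
    by (rule assms) (auto intro!: carrier_vecI)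
  then show ?thesis
    unfolding C1_Rn_def using continuous_Rn_cong[OF assms] partial_cong[OF assms] by simp
qed

lemma C2_Rn_cong:
  assumes "\<And>z. z \<in> carrier_vec n \<Longrightarrow> F z = G z"
  shows "C2_Rn n F \<longleftrightarrow> C2_Rn n G"
  unfolding C2_Rn_def using C1_Rn_cong[OF assms] partial_cong[OF assms] by simp

lemma C1_Rn_has_partial:
  assumes "C1_Rn n F" "i < n" "z \<in> carrier_vec n"
  shows "((\<lambda>t. F (z + t \<cdot>\<^sub>v unit_vec n i)) has_real_derivative partial n i F z) (at 0)"
  using assms by (auto simp: C1_Rn_def partial_def DERIV_deriv_iff_real_differentiable)

lemma partial_eqI:
  assumes "((\<lambda>t. F (z + t \<cdot>\<^sub>v unit_vec n i)) has_real_derivative D) (at 0)"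
  shows "partial n i F z = D"
  using assms by (simp add: partial_def DERIV_imp_deriv)

lemma C1_RnI:
  assumes "continuous_Rn n F" and "\<And>i. i < n \<Longrightarrow> continuous_Rn n (D i)"
    and der: "\<And>i z. i < n \<Longrightarrow> z \<in> carrier_vec n \<Longrightarrow>
      ((\<lambda>t. F (z + t \<cdot>\<^sub>v unit_vec n i)) has_real_derivative D i z) (at 0)"
  shows "C1_Rn n F"
proof -
  have "continuous_Rn n (partial n i F)" if "i < n" for i
    using continuous_Rn_cong[of n "partial n i F" "D i"] partial_eqI[OF der] that assms(2) by auto
  then show ?thesis
    using assms(1) der by (auto simp: C1_Rn_def real_differentiable_def)
qed

lemma C2_RnI:
  assumes "C1_Rn n F" and "\<And>i. i < n \<Longrightarrow> C1_Rn n (D i)"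
    and "\<And>i z. i < n \<Longrightarrow> z \<in> carrier_vec n \<Longrightarrow> partial n i F z = D i z"
  shows "C2_Rn n F"
proof -
  have "C1_Rn n (partial n i F)" if "i < n" for i
    using C1_Rn_cong[of n "partial n i F" "D i"] that assms by auto
  then show ?thesis using assms(1) by (simp add: C2_Rn_def)
qed

lemma continuous_Rn_linear_combination:
  assumes "finite I" "\<And>i. i \<in> I \<Longrightarrow> continuous_Rn n (F i)"
  shows "continuous_Rn n (\<lambda>z. \<Sum>i\<in>I. c i * F i z)"
  using assms unfolding continuous_Rn_def
  by (intro continuous_map_sum continuous_map_real_mult) auto

lemma C1_Rn_linear_combination:
  assumes I: "finite I" and F: "\<And>j. j \<in> I \<Longrightarrow> C1_Rn n (F j)"
  shows "C1_Rn n (\<lambda>z. \<Sum>j\<in>I. c j * F j z)" (is ?C1)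
    and "i < n \<Longrightarrow> z \<in> carrier_vec n \<Longrightarrow>
      partial n i (\<lambda>z. \<Sum>j\<in>I. c j * F j z) z = (\<Sum>j\<in>I. c j * partial n i (F j) z)"
proof -
  have der: "((\<lambda>t. \<Sum>j\<in>I. c j * F j (z + t \<cdot>\<^sub>v unit_vec n i)) has_real_derivative
      (\<Sum>j\<in>I. c j * partial n i (F j) z)) (at 0)" if "i < n" "z \<in> carrier_vec n" for i z
    using C1_Rn_has_partial[OF F that] by (intro DERIV_sum DERIV_cmult)
  show ?C1
    by (rule C1_RnI[where D = "\<lambda>i z. \<Sum>j\<in>I. c j * partial n i (F j) z"])
      (use I F der in \<open>auto intro!: continuous_Rn_linear_combination simp: C1_Rn_def\<close>)
  show "i < n \<Longrightarrow> z \<in> carrier_vec n \<Longrightarrow>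
      partial n i (\<lambda>z. \<Sum>j\<in>I. c j * F j z) z = (\<Sum>j\<in>I. c j * partial n i (F j) z)"
    using der by (intro partial_eqI)
qed

lemma C2_Rn_linear_combination:
  assumes I: "finite I" and F: "\<And>j. j \<in> I \<Longrightarrow> C2_Rn n (F j)"
  shows "C2_Rn n (\<lambda>z. \<Sum>j\<in>I. c j * F j z)" (is ?C2)
    and "i < n \<Longrightarrow> l < n \<Longrightarrow> z \<in> carrier_vec n \<Longrightarrow>
      partial n l (partial n i (\<lambda>z. \<Sum>j\<in>I. c j * F j z)) z
        = (\<Sum>j\<in>I. c j * partial n l (partial n i (F j)) z)"
proof -
  have C1: "\<And>j. j \<in> I \<Longrightarrow> C1_Rn n (F j)"
    and C1': "\<And>i j. j \<in> I \<Longrightarrow> i < n \<Longrightarrow> C1_Rn n (partial n i (F j))"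
    using F by (auto simp: C2_Rn_def)
  note first = C1_Rn_linear_combination[OF I C1]
  note second = C1_Rn_linear_combination[OF I C1']
  show ?C2
    by (rule C2_RnI[OF first(1) second(1) first(2)])
  assume il: "i < n" "l < n" and z: "z \<in> carrier_vec n"
  have "partial n l (partial n i (\<lambda>z. \<Sum>j\<in>I. c j * F j z)) z
      = partial n l (\<lambda>z. \<Sum>j\<in>I. c j * partial n i (F j) z) z"
    by (rule fun_cong[OF partial_cong]) (rule first(2)[OF _ il(1)])
  also have "\<dots> = (\<Sum>j\<in>I. c j * partial n l (partial n i (F j)) z)"
    by (rule second(2)[OF _ il z])
  finally show "partial n l (partial n i (\<lambda>z. \<Sum>j\<in>I. c j * F j z)) z = \<dots>" .
qed

text \<open>The vector of the entries of \<open>z\<close> at the positions \<open>\<phi> 0, \<dots>, \<phi> (m - 1)\<close>. Blocks of stacked vectors are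
of this kind, and so are the pairs of blocks of the states of a system and its abstraction. Everything
about derivatives is proved for an arbitrary injective \<open>\<phi>\<close>, so that the arithmetic of block
offsets stays out of the calculus.\<close>

definition coords :: "nat \<Rightarrow> (nat \<Rightarrow> nat) \<Rightarrow> rvec \<Rightarrow> rvec" where
  "coords m \<phi> z = Matrix.vec m (\<lambda>l. z $ \<phi> l)"

lemma coords_carrier [simp]: "coords m \<phi> z \<in> carrier_vec m"
  by (simp add: coords_def)

lemma index_coords [simp]: "l < m \<Longrightarrow> coords m \<phi> z $ l = z $ \<phi> l" "dim_vec (coords m \<phi> z) = m"
  by (simp_all add: coords_def)

lemma continuous_Rn_coords:
  assumes \<phi>: "\<phi> ` {..<m} \<subseteq> {..<n}" and F: "continuous_Rn m F"
  shows "continuous_Rn n (\<lambda>z. F (coords m \<phi> z))"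
proof -
  have "continuous_map (Euclidean_space n) euclideanreal (\<lambda>a. a (\<phi> l))" for l
    unfolding Euclidean_space_def
    by (intro continuous_map_from_subtopology continuous_map_product_projection) simp
  then have "continuous_map (Euclidean_space n) (Euclidean_space m)
      (\<lambda>a l. if l < m then a (\<phi> l) else 0)"
    by (simp add: continuous_map_componentwise_Euclidean_space)
  then have "continuous_map (Euclidean_space n) euclideanreal
      ((\<lambda>a. F (Matrix.vec m a)) \<circ> (\<lambda>a l. if l < m then a (\<phi> l) else 0))"
    using F unfolding continuous_Rn_def by (rule continuous_map_compose)
  moreover have "Matrix.vec m (\<lambda>l. if l < m then a (\<phi> l) else 0) = coords m \<phi> (Matrix.vec n a)" for a
    using \<phi> by (intro eq_vecI) auto
  ultimately show ?thesis by (simp add: continuous_Rn_def comp_def)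
qed

text \<open>Moving along the \<open>i\<close>-th axis moves the selected coordinates along the \<open>l\<close>-th axis if
\<open>i = \<phi> l\<close>, where \<open>l\<close> is unique by injectivity, and not at all if \<open>i\<close> is not selected. The sum
of indicators covers both cases.\<close>

lemma C1_Rn_coords:
  assumes \<phi>: "\<phi> ` {..<m} \<subseteq> {..<n}" "inj_on \<phi> {..<m}" and F: "C1_Rn m F"
  shows "C1_Rn n (\<lambda>z. F (coords m \<phi> z))" (is ?C1)
    and "i < n \<Longrightarrow> z \<in> carrier_vec n \<Longrightarrow> partial n i (\<lambda>z. F (coords m \<phi> z)) z
      = (\<Sum>l<m. of_bool (\<phi> l = i) * partial m l F (coords m \<phi> z))"
proof -
  let ?D = "\<lambda>i z. \<Sum>l<m. of_bool (\<phi> l = i) * partial m l F (coords m \<phi> z)"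
  have der: "((\<lambda>t. F (coords m \<phi> (z + t \<cdot>\<^sub>v unit_vec n i))) has_real_derivative ?D i z) (at 0)"
    if i: "i < n" and z: "z \<in> carrier_vec n" for i z
  proof (cases "\<exists>l<m. \<phi> l = i")
    case True
    then obtain l where l: "l < m" "\<phi> l = i" by auto
    have uniq: "\<phi> l' = i \<longleftrightarrow> l' = l" if "l' < m" for l'
      using \<phi>(2) l that by (auto dest: inj_onD)
    have "coords m \<phi> (z + t \<cdot>\<^sub>v unit_vec n i) = coords m \<phi> z + t \<cdot>\<^sub>v unit_vec m l" for t
      using \<phi>(1) i l uniq by (intro eq_vecI) auto
    moreover have "?D i z = (\<Sum>l'<m. if l' = l then partial m l' F (coords m \<phi> z) else 0)"
      using uniq by (intro sum.cong) auto
    ultimately show ?thesis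
      using C1_Rn_has_partial[OF F l(1), of "coords m \<phi> z"] l(1) by simp
  next
    case False
    have "coords m \<phi> (z + t \<cdot>\<^sub>v unit_vec n i) = coords m \<phi> z" for t
      using \<phi>(1) i False by (intro eq_vecI) auto
    moreover have "?D i z = 0" using False by (intro sum.neutral) auto
    ultimately show ?thesis by simp
  qed
  show ?C1
  proof (rule C1_RnI[where D = ?D])
    show "continuous_Rn n (\<lambda>z. F (coords m \<phi> z))"
      using F by (intro continuous_Rn_coords[OF \<phi>(1)]) (simp add: C1_Rn_def)
    show "continuous_Rn n (?D i)" for i
      using F by (intro continuous_Rn_linear_combination continuous_Rn_coords[OF \<phi>(1)])
        (auto simp: C1_Rn_def)
  qed (use der in auto)
  show "i < n \<Longrightarrow> z \<in> carrier_vec n \<Longrightarrow> partial n i (\<lambda>z. F (coords m \<phi> z)) z = ?D i z"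
    using der by (intro partial_eqI)
qed

text \<open>The inner derivative is a combination of functions of the same coordinates, so the second derivative
follows from the results about first derivatives; it is left unevaluated here, to be
contracted by \<open>sum_partial_coords\<close>.\<close>

lemma C2_Rn_coords:
  assumes \<phi>: "\<phi> ` {..<m} \<subseteq> {..<n}" "inj_on \<phi> {..<m}" and F: "C2_Rn m F"
  shows "C2_Rn n (\<lambda>z. F (coords m \<phi> z))" (is ?C2)
    and "i < n \<Longrightarrow> j < n \<Longrightarrow> z \<in> carrier_vec n \<Longrightarrow>
      partial n j (partial n i (\<lambda>z. F (coords m \<phi> z))) z
      = (\<Sum>l<m. of_bool (\<phi> l = i) * partial n j (\<lambda>z. partial m l F (coords m \<phi> z)) z)"
proof -
  have C1: "C1_Rn m F" and C1': "\<And>l. l < m \<Longrightarrow> C1_Rn m (partial m l F)"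
    using F by (auto simp: C2_Rn_def)
  note first = C1_Rn_coords[OF \<phi> C1]
  note inner = C1_Rn_coords(1)[OF \<phi> C1']
  let ?D = "\<lambda>i z. \<Sum>l<m. of_bool (\<phi> l = i) * partial m l F (coords m \<phi> z)"
  have D: "C1_Rn n (?D i)" for i
    by (intro C1_Rn_linear_combination(1) inner) auto
  show ?C2
    by (rule C2_RnI[OF first(1) D first(2)])
  assume ij: "i < n" "j < n" and z: "z \<in> carrier_vec n"
  have "partial n j (partial n i (\<lambda>z. F (coords m \<phi> z))) z = partial n j (?D i) z"
    by (rule fun_cong[OF partial_cong]) (rule first(2)[OF ij(1)])
  also have "\<dots> = (\<Sum>l<m. of_bool (\<phi> l = i) * partial n j (\<lambda>z. partial m l F (coords m \<phi> z)) z)"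
    by (intro C1_Rn_linear_combination(2) inner(1) ij z) auto
  finally show "partial n j (partial n i (\<lambda>z. F (coords m \<phi> z))) z = \<dots>" .
qed

lemma sum_index_map:
  fixes X :: "nat \<Rightarrow> nat \<Rightarrow> real"
  assumes \<phi>: "\<phi> ` {..<m} \<subseteq> {..<n}"
  shows "(\<Sum>i<n. \<Sum>l<m. of_bool (\<phi> l = i) * X l i) = (\<Sum>l<m. X l (\<phi> l))"
proof -
  have "(\<Sum>i<n. \<Sum>l<m. of_bool (\<phi> l = i) * X l i) = (\<Sum>l<m. \<Sum>i<n. of_bool (\<phi> l = i) * X l i)"
    by (rule sum.swap)
  also have "\<dots> = (\<Sum>l<m. \<Sum>i<n. if \<phi> l = i then X l i else 0)"
    by (intro sum.cong) auto
  also have "\<dots> = (\<Sum>l<m. X l (\<phi> l))"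
    using \<phi> by (intro sum.cong refl) auto
  finally show ?thesis .
qed

text \<open>The chain rule in contracted form. Both the drift term and, applied twice, the diffusion term
of the generator are instances.\<close>

lemma sum_partial_coords:
  assumes \<phi>: "\<phi> ` {..<m} \<subseteq> {..<n}" "inj_on \<phi> {..<m}" and F: "C1_Rn m F"
    and z: "z \<in> carrier_vec n"
  shows "(\<Sum>i<n. partial n i (\<lambda>z. F (coords m \<phi> z)) z * v i)
    = (\<Sum>l<m. partial m l F (coords m \<phi> z) * v (\<phi> l))"
proof -
  have "(\<Sum>i<n. partial n i (\<lambda>z. F (coords m \<phi> z)) z * v i)
      = (\<Sum>i<n. \<Sum>l<m. of_bool (\<phi> l = i) * (partial m l F (coords m \<phi> z) * v i))"
    unfolding mult.assoc[symmetric] sum_distrib_right[symmetric]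
    using C1_Rn_coords(2)[OF \<phi> F _ z] by (intro sum.cong) auto
  then show ?thesis by (simp only: sum_index_map[OF \<phi>(1)])
qed

lemma gradient_scalar_prod:
  assumes "v \<in> carrier_vec n"
  shows "gradient n F z \<bullet> v = (\<Sum>i<n. partial n i F z * v $ i)"
  using assms by (auto simp: gradient_def scalar_prod_def atLeast0LessThan intro!: sum.cong)

lemma gradient_coords:
  assumes \<phi>: "\<phi> ` {..<m} \<subseteq> {..<n}" "inj_on \<phi> {..<m}" and F: "C1_Rn m F"
    and z: "z \<in> carrier_vec n" and v: "v \<in> carrier_vec n"
  shows "gradient n (\<lambda>z. F (coords m \<phi> z)) z \<bullet> v = gradient m F (coords m \<phi> z) \<bullet> coords m \<phi> v"
  using sum_partial_coords[OF \<phi> F z, of "\<lambda>i. v $ i"]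
  by (simp add: gradient_scalar_prod[OF v] gradient_scalar_prod[OF coords_carrier])

lemma mat_trace_hessian:
  assumes D: "D \<in> carrier_mat n c"
  shows "mat_trace (D * transpose_mat D * hessian n F z)
    = (\<Sum>i<n. \<Sum>j<n. partial n j (partial n i F) z * (row D i \<bullet> row D j))"
proof -
  have "(D * transpose_mat D * hessian n F z) $$ (i, i)
      = (\<Sum>j<n. partial n j (partial n i F) z * (row D i \<bullet> row D j))" if i: "i < n" for i
  proof -
    have H: "hessian n F z \<in> carrier_mat n n" by (simp add: hessian_def)
    have DD: "D * transpose_mat D \<in> carrier_mat n n" using D by auto
    have "(D * transpose_mat D * hessian n F z) $$ (i, i)
        = row (D * transpose_mat D) i \<bullet> col (hessian n F z) i"
      using D H DD i by (intro index_mult_mat(1)) auto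
    also have "\<dots> = (\<Sum>j<n. (D * transpose_mat D) $$ (i, j) * hessian n F z $$ (j, i))"
      using H DD i by (auto simp: scalar_prod_def atLeast0LessThan intro!: sum.cong)
    also have "\<dots> = (\<Sum>j<n. partial n j (partial n i F) z * (row D i \<bullet> row D j))"
      using D i by (intro sum.cong) (auto simp: hessian_def)
    finally show ?thesis .
  qed
  then show ?thesis using D by (simp add: mat_trace_def hessian_def)
qed

text \<open>The matrix \<open>E\<close> consists of the selected rows of \<open>D\<close>. The trace is a double contraction of second
derivatives with the scalar products of rows of \<open>D\<close>; only products of two selected rows survive.\<close>

lemma mat_trace_hessian_coords:
  assumes \<phi>: "\<phi> ` {..<m} \<subseteq> {..<n}" "inj_on \<phi> {..<m}" and F: "C2_Rn m F"
    and z: "z \<in> carrier_vec n" and D: "D \<in> carrier_mat n c" and E: "E \<in> carrier_mat m c"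
    and rows: "\<And>l. l < m \<Longrightarrow> row E l = row D (\<phi> l)"
  shows "mat_trace (D * transpose_mat D * hessian n (\<lambda>z. F (coords m \<phi> z)) z)
    = mat_trace (E * transpose_mat E * hessian m F (coords m \<phi> z))"
proof -
  let ?r = "\<lambda>i j. row D i \<bullet> row D j"
  let ?p = "\<lambda>l j. partial n j (\<lambda>z. partial m l F (coords m \<phi> z)) z"
  have C1: "C1_Rn m (partial m l F)" if "l < m" for l
    using F that by (simp add: C2_Rn_def)
  have inner: "(\<Sum>j<n. partial n j (partial n i (\<lambda>z. F (coords m \<phi> z))) z * ?r i j)
      = (\<Sum>l<m. of_bool (\<phi> l = i) * (\<Sum>j<n. ?p l j * ?r i j))" if i: "i < n" for i
  proof -
    have "(\<Sum>j<n. partial n j (partial n i (\<lambda>z. F (coords m \<phi> z))) z * ?r i j)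
        = (\<Sum>j<n. (\<Sum>l<m. of_bool (\<phi> l = i) * ?p l j) * ?r i j)"
      using C2_Rn_coords(2)[OF \<phi> F i _ z] by (intro sum.cong) auto
    also have "\<dots> = (\<Sum>j<n. \<Sum>l<m. of_bool (\<phi> l = i) * (?p l j * ?r i j))"
      by (simp only: sum_distrib_right mult.assoc)
    also have "\<dots> = (\<Sum>l<m. \<Sum>j<n. of_bool (\<phi> l = i) * (?p l j * ?r i j))"
      by (rule sum.swap)
    also have "\<dots> = (\<Sum>l<m. of_bool (\<phi> l = i) * (\<Sum>j<n. ?p l j * ?r i j))"
      by (simp only: sum_distrib_left)
    finally show ?thesis .
  qed
  have "mat_trace (D * transpose_mat D * hessian n (\<lambda>z. F (coords m \<phi> z)) z)
      = (\<Sum>i<n. \<Sum>l<m. of_bool (\<phi> l = i) * (\<Sum>j<n. ?p l j * ?r i j))"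
    unfolding mat_trace_hessian[OF D] by (rule sum.cong[OF refl]) (rule inner, simp)
  also have "\<dots> = (\<Sum>l<m. \<Sum>j<n. ?p l j * ?r (\<phi> l) j)"
    by (rule sum_index_map[OF \<phi>(1)])
  also have "\<dots> = (\<Sum>l<m. \<Sum>l'<m. partial m l' (partial m l F) (coords m \<phi> z) * ?r (\<phi> l) (\<phi> l'))"
    by (rule sum.cong[OF refl]) (rule sum_partial_coords[OF \<phi> C1 z], simp)
  also have "\<dots> = mat_trace (E * transpose_mat E * hessian m F (coords m \<phi> z))"
    unfolding mat_trace_hessian[OF E] by (intro sum.cong refl) (simp add: rows)
  finally show ?thesis .
qed

lemma gradient_linear_combination:
  assumes I: "finite I" and F: "\<And>j. j \<in> I \<Longrightarrow> C1_Rn n (F j)"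
    and z: "z \<in> carrier_vec n" and v: "v \<in> carrier_vec n"
  shows "gradient n (\<lambda>z. \<Sum>j\<in>I. c j * F j z) z \<bullet> v = (\<Sum>j\<in>I. c j * (gradient n (F j) z \<bullet> v))"
proof -
  have "gradient n (\<lambda>z. \<Sum>j\<in>I. c j * F j z) z \<bullet> v
      = (\<Sum>i<n. (\<Sum>j\<in>I. c j * partial n i (F j) z) * v $ i)"
    using v C1_Rn_linear_combination(2)[OF I F _ z, where c = c]
    by (auto simp: gradient_def scalar_prod_def atLeast0LessThan intro!: sum.cong)
  also have "\<dots> = (\<Sum>i<n. \<Sum>j\<in>I. c j * (partial n i (F j) z * v $ i))"
    by (simp add: sum_distrib_right mult.assoc)
  also have "\<dots> = (\<Sum>j\<in>I. \<Sum>i<n. c j * (partial n i (F j) z * v $ i))"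
    by (rule sum.swap)
  also have "\<dots> = (\<Sum>j\<in>I. c j * (gradient n (F j) z \<bullet> v))"
    using v by (auto simp: gradient_def scalar_prod_def atLeast0LessThan sum_distrib_left
        intro!: sum.cong)
  finally show ?thesis .
qed

lemma mat_trace_hessian_linear_combination:
  assumes I: "finite I" and F: "\<And>j. j \<in> I \<Longrightarrow> C2_Rn n (F j)"
    and z: "z \<in> carrier_vec n" and D: "D \<in> carrier_mat n e"
  shows "mat_trace (D * transpose_mat D * hessian n (\<lambda>z. \<Sum>j\<in>I. c j * F j z) z)
    = (\<Sum>j\<in>I. c j * mat_trace (D * transpose_mat D * hessian n (F j) z))"
proof -
  let ?r = "\<lambda>i i'. row D i \<bullet> row D i'"
  let ?p = "\<lambda>j i i'. partial n i' (partial n i (F j)) z"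
  have "mat_trace (D * transpose_mat D * hessian n (\<lambda>z. \<Sum>j\<in>I. c j * F j z) z)
      = (\<Sum>i<n. \<Sum>i'<n. (\<Sum>j\<in>I. c j * ?p j i i') * ?r i i')"
    unfolding mat_trace_hessian[OF D]
    using C2_Rn_linear_combination(2)[OF I F _ _ z, where c = c] by (intro sum.cong) auto
  also have "\<dots> = (\<Sum>i<n. \<Sum>i'<n. \<Sum>j\<in>I. c j * (?p j i i' * ?r i i'))"
    by (simp only: sum_distrib_right mult.assoc)
  also have "\<dots> = (\<Sum>i<n. \<Sum>j\<in>I. \<Sum>i'<n. c j * (?p j i i' * ?r i i'))"
    by (intro sum.cong refl sum.swap)
  also have "\<dots> = (\<Sum>j\<in>I. \<Sum>i<n. \<Sum>i'<n. c j * (?p j i i' * ?r i i'))"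
    by (rule sum.swap)
  also have "\<dots> = (\<Sum>j\<in>I. c j * mat_trace (D * transpose_mat D * hessian n (F j) z))"
    by (simp only: mat_trace_hessian[OF D] sum_distrib_left)
  finally show ?thesis .
qed

section \<open>Blocks of stacked vectors and matrices\<close>

lemma offset_less:
  fixes d :: "nat \<Rightarrow> nat"
  assumes "i < N" "l < d i"
  shows "(\<Sum>j<i. d j) + l < (\<Sum>j<N. d j)"
proof -
  have "(\<Sum>j<Suc i. d j) \<le> (\<Sum>j<N. d j)"
    using assms by (intro sum_mono2) auto
  then show ?thesis using assms by simp
qed

lemma block_eq_coords: "block d i = coords (d i) (\<lambda>l. (\<Sum>j<i. d j) + l)"
  by (auto simp: block_def coords_def)

lemma block_carrier [simp]: "block d i x \<in> carrier_vec (d i)"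
  by (simp add: block_def)

lemma block_add:
  assumes "i < N" "y \<in> carrier_vec (\<Sum>j<N. d j)"
  shows "block d i (x + y) = block d i x + block d i y"
  using assms offset_less[OF assms(1)] by (intro eq_vecI) (auto simp: block_def)

text \<open>The positions, within \<open>[x; \<hat>x]\<close> with \<open>x\<close> of dimension \<open>n\<close>, of the entries of \<open>[x\<^sub>i; \<hat>x\<^sub>i]\<close>.\<close>

definition pair_index :: "nat \<Rightarrow> (nat \<Rightarrow> nat) \<Rightarrow> (nat \<Rightarrow> nat) \<Rightarrow> nat \<Rightarrow> nat \<Rightarrow> nat" where
  "pair_index n d d' i l =
    (if l < d i then (\<Sum>j<i. d j) + l else n + ((\<Sum>j<i. d' j) + (l - d i)))"

lemma pair_index:
  assumes i: "i < N" and n: "n = (\<Sum>j<N. d j)" "n' = (\<Sum>j<N. d' j)"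
  shows "pair_index n d d' i ` {..<d i + d' i} \<subseteq> {..<n + n'}"
    and "inj_on (pair_index n d d' i) {..<d i + d' i}"
    and "x \<in> carrier_vec n \<Longrightarrow> x' \<in> carrier_vec n' \<Longrightarrow>
      coords (d i + d' i) (pair_index n d d' i) (x @\<^sub>v x') = block d i x @\<^sub>v block d' i x'"
proof -
  have less: "l < d i \<Longrightarrow> (\<Sum>j<i. d j) + l < n" "l' < d' i \<Longrightarrow> (\<Sum>j<i. d' j) + l' < n'" for l l'
    using offset_less[OF i] n by auto
  have less': "l < d i + d' i \<Longrightarrow> \<not> l < d i \<Longrightarrow> (\<Sum>j<i. d' j) + (l - d i) < n'" for l
    by (rule less(2)) simp
  show "pair_index n d d' i ` {..<d i + d' i} \<subseteq> {..<n + n'}"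
  proof (rule image_subsetI)
    fix l assume "l \<in> {..<d i + d' i}"
    then show "pair_index n d d' i l \<in> {..<n + n'}"
      using less(1)[of l] less'[of l] unfolding pair_index_def by (cases "l < d i") auto
  qed
  show "inj_on (pair_index n d d' i) {..<d i + d' i}"
  proof (rule inj_onI)
    fix l l' assume "l \<in> {..<d i + d' i}" "l' \<in> {..<d i + d' i}"
      "pair_index n d d' i l = pair_index n d d' i l'"
    then show "l = l'"
      using less(1)[of l] less(1)[of l'] by (auto simp: pair_index_def split: if_splits)
  qed
  show "coords (d i + d' i) (pair_index n d d' i) (x @\<^sub>v x') = block d i x @\<^sub>v block d' i x'"
    if x: "x \<in> carrier_vec n" and x': "x' \<in> carrier_vec n'"
  proof (rule eq_vecI)
    fix l assume "l < dim_vec (block d i x @\<^sub>v block d' i x')"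
    then have l: "l < d i + d' i" by (simp add: block_def)
    have dims: "dim_vec x = n" "dim_vec x' = n'" using x x' by auto
    show "coords (d i + d' i) (pair_index n d d' i) (x @\<^sub>v x') $ l = (block d i x @\<^sub>v block d' i x') $ l"
    proof (cases "l < d i")
      case True
      then show ?thesis using less(1)[of l] l dims by (simp add: pair_index_def block_def)
    next
      case False
      then obtain l' where "l = d i + l'" by (metis le_Suc_ex linorder_not_less)
      then show ?thesis using less(2)[of l'] l dims by (simp add: pair_index_def block_def)
    qed
  qed (simp add: block_def)
qed

lemma on_stacked_append:
  assumes "x \<in> carrier_vec n" "x' \<in> carrier_vec n'"
  shows "on_stacked n n' V (x @\<^sub>v x') = V x x'"
proof -
  have "vec_first (x @\<^sub>v x') n = x" "vec_last (x @\<^sub>v x') n' = x'"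
    using assms by (auto simp: vec_first_def vec_last_def intro!: eq_vecI)
  then show ?thesis by (simp add: on_stacked_def)
qed

text \<open>A weighted sum over pairs of blocks is a linear combination of functions of selected coordinates,
which is the form to which the calculus above applies.\<close>

lemma on_stacked_block_sum:
  assumes n: "n = (\<Sum>j<N. d j)" "n' = (\<Sum>j<N. d' j)" and z: "z \<in> carrier_vec (n + n')"
  shows "on_stacked n n' (\<lambda>x x'. \<Sum>i<N. c i * V i (block d i x) (block d' i x')) z
    = (\<Sum>i<N. c i * on_stacked (d i) (d' i) (V i) (coords (d i + d' i) (pair_index n d d' i) z))"
proof -
  let ?x = "vec_first z n" and ?x' = "vec_last z n'"
  have "on_stacked (d i) (d' i) (V i) (coords (d i + d' i) (pair_index n d d' i) z)
      = V i (block d i ?x) (block d' i ?x')" if "i < N" for i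
    using pair_index(3)[OF that n, of ?x ?x'] z by (simp add: on_stacked_append)
  then show ?thesis by (simp add: on_stacked_def)
qed

lemma stack_vecs_carrier:
  assumes "\<And>i. i < N \<Longrightarrow> v i \<in> carrier_vec (d i)"
  shows "stack_vecs (map v [0..<N]) \<in> carrier_vec (\<Sum>i<N. d i)"
proof -
  have "dim_vec (stack_vecs (map v [0..<N])) = (\<Sum>i<N. dim_vec (v i))"
    by (simp add: dim_stack_vecs sum_list_distinct_conv_sum_set atLeast0LessThan)
  also have "\<dots> = (\<Sum>i<N. d i)" using assms by (intro sum.cong) auto
  finally show ?thesis by (rule carrier_vecI)
qed

lemma col_append_rows:
  assumes "A \<in> carrier_mat r c" "B \<in> carrier_mat r' c" "j < c"
  shows "col (A @\<^sub>r B) j = col A j @\<^sub>v col B j"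
  using assms by (intro eq_vecI) (auto simp: append_rows_def)

lemma row_append_rows:
  assumes A: "A \<in> carrier_mat r c" and B: "B \<in> carrier_mat r' c" and "i < r + r'"
  shows "row (A @\<^sub>r B) i = (if i < r then row A i else row B (i - r))"
  using assms by (intro eq_vecI) (auto simp: append_rows_def)

text \<open>The columns of stacked matrices are stacked columns, which reduces statements about stacked matrices to
\<open>block_stack_vecs\<close>.\<close>

lemma stack_mats_columns:
  assumes "\<And>A. A \<in> set As \<Longrightarrow> dim_col A = c"
  shows "stack_mats c As \<in> carrier_mat (sum_list (map dim_row As)) c"
    and "j < c \<Longrightarrow> col (stack_mats c As) j = stack_vecs (map (\<lambda>A. col A j) As)"
proof -
  have "stack_mats c As \<in> carrier_mat (sum_list (map dim_row As)) c \<and>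
    (j < c \<longrightarrow> col (stack_mats c As) j = stack_vecs (map (\<lambda>A. col A j) As))"
    using assms
  proof (induction As)
    case Nil
    show ?case by (auto simp: stack_mats_def stack_vecs_def)
  next
    case (Cons A As)
    let ?R = "stack_mats c As"
    have A: "A \<in> carrier_mat (dim_row A) c" using Cons.prems by (auto intro: carrier_matI)
    have R: "?R \<in> carrier_mat (sum_list (map dim_row As)) c"
      and col: "j < c \<longrightarrow> col ?R j = stack_vecs (map (\<lambda>A. col A j) As)"
      using Cons.IH Cons.prems by auto
    have "stack_mats c (A # As) = A @\<^sub>r ?R" by (simp add: stack_mats_def)
    then show ?case
      using carrier_append_rows[OF A R] col_append_rows[OF A R] col by (simp add: stack_vecs_def)
  qed
  then show "stack_mats c As \<in> carrier_mat (sum_list (map dim_row As)) c"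
    and "j < c \<Longrightarrow> col (stack_mats c As) j = stack_vecs (map (\<lambda>A. col A j) As)" by auto
qed

lemma stack_mats_blocks:
  assumes A: "\<And>i. i < N \<Longrightarrow> A i \<in> carrier_mat (d i) c"
  shows "stack_mats c (map A [0..<N]) \<in> carrier_mat (\<Sum>i<N. d i) c"
    and "i < N \<Longrightarrow> j < c \<Longrightarrow> block d i (col (stack_mats c (map A [0..<N])) j) = col (A i) j"
    and "i < N \<Longrightarrow> l < d i \<Longrightarrow> row (stack_mats c (map A [0..<N])) ((\<Sum>j<i. d j) + l) = row (A i) l"
proof -
  let ?S = "stack_mats c (map A [0..<N])"
  have dims: "dim_col B = c" if "B \<in> set (map A [0..<N])" for B
    using A that by fastforce
  have "sum_list (map dim_row (map A [0..<N])) = (\<Sum>i<N. dim_row (A i))"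
    by (simp add: sum_list_distinct_conv_sum_set atLeast0LessThan)
  also have "\<dots> = (\<Sum>i<N. d i)" using A by (intro sum.cong) auto
  finally show S: "?S \<in> carrier_mat (\<Sum>i<N. d i) c"
    using stack_mats_columns(1)[of "map A [0..<N]" c, OF dims] by simp
  show col: "block d i (col ?S j) = col (A i) j" if "i < N" "j < c" for i j
  proof -
    have "col ?S j = stack_vecs (map (\<lambda>i. col (A i) j) [0..<N])"
      using stack_mats_columns(2)[of "map A [0..<N]" c, OF dims that(2)] by (simp add: comp_def)
    then show ?thesis using A that by (simp add: block_stack_vecs[where d = d])
  qed
  show "row ?S ((\<Sum>j<i. d j) + l) = row (A i) l" if i: "i < N" and l: "l < d i"
  proof (rule eq_vecI)
    have r: "(\<Sum>j<i. d j) + l < (\<Sum>j<N. d j)" by (rule offset_less) fact+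
    show "dim_vec (row ?S ((\<Sum>j<i. d j) + l)) = dim_vec (row (A i) l)" using S A[OF i] by auto
    fix j assume "j < dim_vec (row (A i) l)"
    then have j: "j < c" using A[OF i] by auto
    have "row ?S ((\<Sum>j<i. d j) + l) $ j = block d i (col ?S j) $ l"
      using S r j l by (simp add: block_def)
    also have "\<dots> = row (A i) l $ j" using col[OF i j] A[OF i] l j by simp
    finally show "row ?S ((\<Sum>j<i. d j) + l) $ j = row (A i) l $ j" .
  qed
qed

lemma mult_mat_unit_vec:
  fixes A :: rmat
  assumes "A \<in> carrier_mat r c" "j < c"
  shows "A *\<^sub>v unit_vec c j = col A j"
  using assms by (intro eq_vecI) auto

section \<open>The generator of a weighted sum over subsystems\<close>

lemma C2_Rn_block_sum:
  assumes n: "n = (\<Sum>j<N. d j)" "n' = (\<Sum>j<N. d' j)"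
    and C2: "\<And>i. i < N \<Longrightarrow> C2_Rn (d i + d' i) (on_stacked (d i) (d' i) (V i))"
  shows "C2_Rn (n + n') (on_stacked n n' (\<lambda>x x'. \<Sum>i<N. c i * V i (block d i x) (block d' i x')))"
proof -
  let ?H = "\<lambda>i z. on_stacked (d i) (d' i) (V i) (coords (d i + d' i) (pair_index n d d' i) z)"
  have "C2_Rn (n + n') (\<lambda>z. \<Sum>i<N. c i * ?H i z)"
  proof (rule C2_Rn_linear_combination(1)[where F = ?H])
    fix i assume "i \<in> {..<N}"
    then have i: "i < N" by simp
    show "C2_Rn (n + n') (?H i)"
      by (rule C2_Rn_coords(1)[OF pair_index(1,2)[OF i n] C2[OF i]])
  qed simp
  moreover have "C2_Rn (n + n') (on_stacked n n' (\<lambda>x x'. \<Sum>i<N. c i * V i (block d i x) (block d' i x')))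
      \<longleftrightarrow> C2_Rn (n + n') (\<lambda>z. \<Sum>i<N. c i * ?H i z)"
    by (rule C2_Rn_cong) (rule on_stacked_block_sum[OF n])
  ultimately show ?thesis by simp
qed

text \<open>Each of the three parts of the generator is linear in the function. On the \<open>i\<close>-th summand, which depends
on the coordinates selected by \<open>pair_index\<close> only, each part reduces to the corresponding part for
the \<open>i\<close>-th pair of systems. The values \<open>b\<close> and \<open>b'\<close> of the drifts are parameters of the generator, so
that \<open>T\<close> and \<open>T'\<close> may be systems without internal inputs although the subsystems have them.\<close>

lemma generator_block_sum:
  fixes N :: nat
    and S S' :: "nat \<Rightarrow> ('w, 'c) system_base_scheme"
    and T T' :: "('w, 'd) system_base_scheme"
  defines "d \<equiv> \<lambda>i. state_dim (S i)" and "d' \<equiv> \<lambda>i. state_dim (S' i)"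
  defines "n \<equiv> \<Sum>i<N. d i" and "n' \<equiv> \<Sum>i<N. d' i"
  assumes dims: "state_dim T = n" "state_dim T' = n'"
    and x: "x \<in> carrier_vec n" "x' \<in> carrier_vec n'"
    and b: "b \<in> carrier_vec n" "b' \<in> carrier_vec n'"
    and C2: "\<And>i. i < N \<Longrightarrow> C2_Rn (d i + d' i) (on_stacked (d i) (d' i) (V i))"
    and diff: "\<And>i. i < N \<Longrightarrow> diffusion (S i) (block d i x) \<in> carrier_mat (d i) pt"
      "\<And>i. i < N \<Longrightarrow> diffusion (S' i) (block d' i x') \<in> carrier_mat (d' i) pt"
    and jump: "\<And>i. i < N \<Longrightarrow> jump (S i) (block d i x) \<in> carrier_mat (d i) qt"
      "\<And>i. i < N \<Longrightarrow> jump (S' i) (block d' i x') \<in> carrier_mat (d' i) qt"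
    and stacked: "diffusion T x = stack_mats pt (map (\<lambda>i. diffusion (S i) (block d i x)) [0..<N])"
      "diffusion T' x' = stack_mats pt (map (\<lambda>i. diffusion (S' i) (block d' i x')) [0..<N])"
      "jump T x = stack_mats qt (map (\<lambda>i. jump (S i) (block d i x)) [0..<N])"
      "jump T' x' = stack_mats qt (map (\<lambda>i. jump (S' i) (block d' i x')) [0..<N])"
  shows "generator qt lam T T' (\<lambda>x x'. \<Sum>i<N. c i * V i (block d i x) (block d' i x')) b b' x x'
    = (\<Sum>i<N. c i * generator qt lam (S i) (S' i) (V i) (block d i b) (block d' i b')
        (block d i x) (block d' i x'))"
proof -
  let ?V = "\<lambda>x x'. \<Sum>i<N. c i * V i (block d i x) (block d' i x')"
  let ?G = "on_stacked n n' ?V"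
  let ?F = "\<lambda>i. on_stacked (d i) (d' i) (V i)"
  let ?\<phi> = "pair_index n d d'"
  let ?H = "\<lambda>i z. ?F i (coords (d i + d' i) (?\<phi> i) z)"
  let ?z = "x @\<^sub>v x'" and ?b = "b @\<^sub>v b'"
  let ?zi = "\<lambda>i. block d i x @\<^sub>v block d' i x'"
  let ?D = "diffusion T x @\<^sub>r diffusion T' x'"
  let ?Di = "\<lambda>i. diffusion (S i) (block d i x) @\<^sub>r diffusion (S' i) (block d' i x')"
  have n: "n = (\<Sum>j<N. d j)" "n' = (\<Sum>j<N. d' j)" by (simp_all add: n_def n'_def)
  note \<phi> = pair_index[OF _ n]
  have z: "?z \<in> carrier_vec (n + n')" "?b \<in> carrier_vec (n + n')" using x b by auto
  have G: "?G z = (\<Sum>i<N. c i * ?H i z)" if "z \<in> carrier_vec (n + n')" for z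
    by (rule on_stacked_block_sum[OF n that])
  have partial_G: "partial (n + n') i ?G = partial (n + n') i (\<lambda>z. \<Sum>i<N. c i * ?H i z)" for i
    by (rule partial_cong[OF G])
  have H: "C2_Rn (n + n') (?H i)" if "i < N" for i
    by (rule C2_Rn_coords(1)[OF \<phi>(1,2)[OF that] C2[OF that]])
  have H1: "C1_Rn (n + n') (?H i)" and F1: "C1_Rn (d i + d' i) (?F i)" if "i < N" for i
    using H[OF that] C2[OF that] by (auto simp: C2_Rn_def)
  have grad: "gradient (n + n') ?G ?z \<bullet> ?b
      = (\<Sum>i<N. c i * (gradient (d i + d' i) (?F i) (?zi i) \<bullet> (block d i b @\<^sub>v block d' i b')))"
  proof -
    have "gradient (n + n') ?G ?z \<bullet> ?b = gradient (n + n') (\<lambda>z. \<Sum>i<N. c i * ?H i z) ?z \<bullet> ?b"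
      unfolding gradient_def partial_G ..
    also have "\<dots> = (\<Sum>i<N. c i * (gradient (n + n') (?H i) ?z \<bullet> ?b))"
      by (rule gradient_linear_combination[where F = ?H, OF _ _ z]) (simp_all add: H1)
    also have "\<dots> = (\<Sum>i<N. c i * (gradient (d i + d' i) (?F i) (?zi i) \<bullet> (block d i b @\<^sub>v block d' i b')))"
    proof (intro sum.cong refl arg_cong2[where f = "(*)"])
      fix i assume "i \<in> {..<N}"
      then have i: "i < N" by simp
      show "gradient (n + n') (?H i) ?z \<bullet> ?b
          = gradient (d i + d' i) (?F i) (?zi i) \<bullet> (block d i b @\<^sub>v block d' i b')"
        using gradient_coords[OF \<phi>(1,2)[OF i] F1[OF i] z]
        unfolding \<phi>(3)[OF i x] \<phi>(3)[OF i b] .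
    qed
    finally show ?thesis .
  qed
  have D: "?D \<in> carrier_mat (n + n') pt"
    unfolding stacked n
    by (rule carrier_append_rows[OF stack_mats_blocks(1)[OF diff(1)] stack_mats_blocks(1)[OF diff(2)]])
  have Di: "?Di i \<in> carrier_mat (d i + d' i) pt" if "i < N" for i
    by (intro carrier_append_rows diff that)
  have rows: "row (?Di i) l = row ?D (?\<phi> i l)" if i: "i < N" and l: "l < d i + d' i" for i l
  proof -
    have T: "diffusion T x \<in> carrier_mat n pt" "diffusion T' x' \<in> carrier_mat n' pt"
      unfolding stacked n
      by (rule stack_mats_blocks(1)[OF diff(1)], assumption)
        (rule stack_mats_blocks(1)[OF diff(2)])
    have rT: "row (diffusion T x) ((\<Sum>j<i. d j) + l) = row (diffusion (S i) (block d i x)) l"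
      if l': "l < d i" for l
      unfolding stacked by (rule stack_mats_blocks(3)[where d = d, OF _ i l']) (rule diff(1))
    have rT': "row (diffusion T' x') ((\<Sum>j<i. d' j) + l) = row (diffusion (S' i) (block d' i x')) l"
      if l': "l < d' i" for l
      unfolding stacked by (rule stack_mats_blocks(3)[where d = d', OF _ i l']) (rule diff(2))
    have "?\<phi> i l < n + n'" using \<phi>(1)[OF i] l by auto
    then have "row ?D (?\<phi> i l) = (if ?\<phi> i l < n then row (diffusion T x) (?\<phi> i l)
        else row (diffusion T' x') (?\<phi> i l - n))"
      by (rule row_append_rows[OF T])
    also have "\<dots> = (if l < d i then row (diffusion (S i) (block d i x)) l
        else row (diffusion (S' i) (block d' i x')) (l - d i))"
      using rT[of l] rT'[of "l - d i"] offset_less[OF i, of l d] l n by (auto simp: pair_index_def)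
    also have "\<dots> = row (?Di i) l"
      by (rule row_append_rows[OF diff(1)[OF i] diff(2)[OF i] l, symmetric])
    finally show ?thesis by simp
  qed
  have trace: "mat_trace (?D * transpose_mat ?D * hessian (n + n') ?G ?z)
      = (\<Sum>i<N. c i * mat_trace (?Di i * transpose_mat (?Di i) * hessian (d i + d' i) (?F i) (?zi i)))"
  proof -
    have "mat_trace (?D * transpose_mat ?D * hessian (n + n') ?G ?z)
        = mat_trace (?D * transpose_mat ?D * hessian (n + n') (\<lambda>z. \<Sum>i<N. c i * ?H i z) ?z)"
      unfolding hessian_def partial_G ..
    also have "\<dots> = (\<Sum>i<N. c i * mat_trace (?D * transpose_mat ?D * hessian (n + n') (?H i) ?z))"
      by (rule mat_trace_hessian_linear_combination[where F = ?H, OF _ _ z(1) D]) (simp_all add: H)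
    also have "\<dots> = (\<Sum>i<N. c i * mat_trace (?Di i * transpose_mat (?Di i) * hessian (d i + d' i) (?F i) (?zi i)))"
    proof (intro sum.cong refl arg_cong2[where f = "(*)"])
      fix i assume "i \<in> {..<N}"
      then have i: "i < N" by simp
      show "mat_trace (?D * transpose_mat ?D * hessian (n + n') (?H i) ?z)
          = mat_trace (?Di i * transpose_mat (?Di i) * hessian (d i + d' i) (?F i) (?zi i))"
        using mat_trace_hessian_coords[OF \<phi>(1,2)[OF i] C2[OF i] z(1) D Di[OF i] rows[OF i]]
        unfolding \<phi>(3)[OF i x] .
    qed
    finally show ?thesis .
  qed
  have jumps: "?V (x + jump T x *\<^sub>v unit_vec qt e) (x' + jump T' x' *\<^sub>v unit_vec qt e)
      = (\<Sum>i<N. c i * V i (block d i x + jump (S i) (block d i x) *\<^sub>v unit_vec qt e)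
          (block d' i x' + jump (S' i) (block d' i x') *\<^sub>v unit_vec qt e))" if e: "e < qt" for e
  proof (intro sum.cong refl arg_cong2[where f = "(*)"] arg_cong2[of _ _ _ _ "V _"])
    fix i assume "i \<in> {..<N}"
    then have i: "i < N" by simp
    have T: "jump T x \<in> carrier_mat n qt" "jump T' x' \<in> carrier_mat n' qt"
      unfolding stacked n
      by (rule stack_mats_blocks(1)[OF jump(1)], assumption)
        (rule stack_mats_blocks(1)[OF jump(2)])
    have "block d i (col (jump T x) e) = col (jump (S i) (block d i x)) e"
      unfolding stacked by (rule stack_mats_blocks(2)[where d = d, OF _ i e]) (rule jump(1))
    then show "block d i (x + jump T x *\<^sub>v unit_vec qt e)
        = block d i x + jump (S i) (block d i x) *\<^sub>v unit_vec qt e"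
      using block_add[OF i, of "col (jump T x) e" d x] T(1) n jump(1)[OF i] e
      by (simp add: mult_mat_unit_vec)
    have "block d' i (col (jump T' x') e) = col (jump (S' i) (block d' i x')) e"
      unfolding stacked by (rule stack_mats_blocks(2)[where d = d', OF _ i e]) (rule jump(2))
    then show "block d' i (x' + jump T' x' *\<^sub>v unit_vec qt e)
        = block d' i x' + jump (S' i) (block d' i x') *\<^sub>v unit_vec qt e"
      using block_add[OF i, of "col (jump T' x') e" d' x'] T(2) n jump(2)[OF i] e
      by (simp add: mult_mat_unit_vec)
  qed
  have jump_sum: "(\<Sum>e<qt. lam e * (?V (x + jump T x *\<^sub>v unit_vec qt e) (x' + jump T' x' *\<^sub>v unit_vec qt e)
        - ?V x x'))
      = (\<Sum>i<N. c i * (\<Sum>e<qt. lam e *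
          (V i (block d i x + jump (S i) (block d i x) *\<^sub>v unit_vec qt e)
            (block d' i x' + jump (S' i) (block d' i x') *\<^sub>v unit_vec qt e)
          - V i (block d i x) (block d' i x'))))" (is "_ = (\<Sum>i<N. c i * (\<Sum>e<qt. lam e * ?J i e))")
  proof -
    have "(\<Sum>e<qt. lam e * (?V (x + jump T x *\<^sub>v unit_vec qt e) (x' + jump T' x' *\<^sub>v unit_vec qt e)
        - ?V x x')) = (\<Sum>e<qt. \<Sum>i<N. c i * (lam e * ?J i e))"
      by (intro sum.cong refl)
        (simp add: jumps sum_subtractf[symmetric] sum_distrib_left algebra_simps)
    also have "\<dots> = (\<Sum>i<N. \<Sum>e<qt. c i * (lam e * ?J i e))"
      by (rule sum.swap)
    finally show ?thesis by (simp only: sum_distrib_left)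
  qed
  have Gen: "generator qt lam T T' ?V b b' x x' = gradient (n + n') ?G ?z \<bullet> ?b
      + 1 / 2 * mat_trace (?D * transpose_mat ?D * hessian (n + n') ?G ?z)
      + (\<Sum>e<qt. lam e * (?V (x + jump T x *\<^sub>v unit_vec qt e) (x' + jump T' x' *\<^sub>v unit_vec qt e)
        - ?V x x'))"
    unfolding generator_def Let_def dims by simp
  have Gen_i: "generator qt lam (S i) (S' i) (V i) (block d i b) (block d' i b') (block d i x) (block d' i x')
      = gradient (d i + d' i) (?F i) (?zi i) \<bullet> (block d i b @\<^sub>v block d' i b')
      + 1 / 2 * mat_trace (?Di i * transpose_mat (?Di i) * hessian (d i + d' i) (?F i) (?zi i))
      + (\<Sum>e<qt. lam e * ?J i e)" for i
    unfolding generator_def Let_def by (simp add: d_def d'_def)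
  show ?thesis
    unfolding Gen Gen_i grad trace jump_sum
    by (simp add: distrib_left sum.distrib sum_distrib_left mult.left_commute)
qed

section \<open>Norms of stacked vectors\<close>

lemma euclid_norm_nonneg [simp]: "0 \<le> euclid_norm x"
  by (auto simp: euclid_norm_def scalar_prod_def intro!: sum_nonneg)

lemma scalar_prod_self: "x \<bullet> x = (euclid_norm x)\<^sup>2"
proof -
  have "0 \<le> x \<bullet> x" by (auto simp: scalar_prod_def intro!: sum_nonneg)
  then show ?thesis by (simp add: euclid_norm_def)
qed

lemma euclid_norm_power2: "(euclid_norm x)\<^sup>2 = (\<Sum>i<dim_vec x. (x $ i)\<^sup>2)"
  unfolding scalar_prod_self[symmetric]
  by (simp add: scalar_prod_def atLeast0LessThan power2_eq_square)

lemma euclid_norm_append: "(euclid_norm (x @\<^sub>v y))\<^sup>2 = (euclid_norm x)\<^sup>2 + (euclid_norm y)\<^sup>2"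
  unfolding scalar_prod_self[symmetric]
  by (rule scalar_prod_append[of _ "dim_vec x" _ "dim_vec y"]) auto

lemma euclid_norm_coords_le:
  assumes \<phi>: "\<phi> ` {..<m} \<subseteq> {..<n}" "inj_on \<phi> {..<m}" and z: "z \<in> carrier_vec n"
  shows "euclid_norm (coords m \<phi> z) \<le> euclid_norm z"
proof (rule power2_le_imp_le)
  have "(euclid_norm (coords m \<phi> z))\<^sup>2 = (\<Sum>l<m. (z $ \<phi> l)\<^sup>2)"
    by (simp add: euclid_norm_power2)
  also have "\<dots> = (\<Sum>i\<in>\<phi> ` {..<m}. (z $ i)\<^sup>2)"
    using \<phi>(2) by (simp add: sum.reindex)
  also have "\<dots> \<le> (\<Sum>i<n. (z $ i)\<^sup>2)"
    using \<phi>(1) by (intro sum_mono2) auto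
  also have "\<dots> = (euclid_norm z)\<^sup>2" using z by (simp add: euclid_norm_power2)
  finally show "(euclid_norm (coords m \<phi> z))\<^sup>2 \<le> (euclid_norm z)\<^sup>2" .
qed simp

lemma euclid_norm_block_le:
  assumes "i < N" "x \<in> carrier_vec (\<Sum>j<N. d j)"
  shows "euclid_norm (block d i x) \<le> euclid_norm x"
  unfolding block_eq_coords using offset_less[OF assms(1)] assms(2)
  by (intro euclid_norm_coords_le) (auto simp: inj_on_def)

lemma block_diff:
  assumes "i < N" "y \<in> carrier_vec (\<Sum>j<N. d j)"
  shows "block d i (x - y) = block d i x - block d i y"
  using assms offset_less[OF assms(1)] by (intro eq_vecI) (auto simp: block_def)

lemma append_vec_diff:
  fixes a b :: rvec
  assumes "dim_vec a = dim_vec c" "dim_vec b = dim_vec e"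
  shows "(a @\<^sub>v b) - (c @\<^sub>v e) = (a - c) @\<^sub>v (b - e)"
  using assms by (intro eq_vecI) auto

lemma euclid_norm_stack_vecs_diff:
  assumes "\<And>j. j \<in> set js \<Longrightarrow> dim_vec (f j) = dim_vec (g j)"
  shows "(euclid_norm (stack_vecs (map f js) - stack_vecs (map g js)))\<^sup>2
    = (\<Sum>j\<leftarrow>js. (euclid_norm (f j - g j))\<^sup>2)"
  using assms
proof (induction js)
  case Nil
  show ?case by (simp add: stack_vecs_def euclid_norm_power2)
next
  case (Cons j js)
  have "dim_vec (stack_vecs (map f js)) = dim_vec (stack_vecs (map g js))"
    unfolding dim_stack_vecs map_map using Cons.prems by (intro arg_cong[where f = sum_list]) auto
  then show ?case
    using Cons append_vec_diff[of "f j" "g j" "stack_vecs (map f js)" "stack_vecs (map g js)"]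
    by (simp add: stack_vecs_def euclid_norm_append)
qed

text \<open>The square of the norm is a sum of squares, at most \<open>card J\<close> times the largest one; this is
the origin of the exponent \<open>k / 2\<close>.\<close>

lemma euclid_norm_stack_vecs_diff_le:
  assumes js: "distinct js" "set js = J" "J \<noteq> {}"
    and dims: "\<And>j. j \<in> J \<Longrightarrow> dim_vec (f j) = dim_vec (g j)" and k: "0 \<le> k"
  shows "\<exists>j\<in>J. euclid_norm (stack_vecs (map f js) - stack_vecs (map g js)) powr k
    \<le> real (card J) powr (k / 2) * euclid_norm (f j - g j) powr k"
proof -
  let ?r = "\<lambda>j. euclid_norm (f j - g j)"
  let ?s = "euclid_norm (stack_vecs (map f js) - stack_vecs (map g js))"
  have J: "finite J" using js by auto
  then have "Max (?r ` J) \<in> ?r ` J" using js(3) by (intro Max_in) auto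
  then obtain j where j: "j \<in> J" "Max (?r ` J) = ?r j" by auto
  have max: "?r i \<le> ?r j" if "i \<in> J" for i
    unfolding j(2)[symmetric] using J that by (intro Max_ge) auto
  have "?s\<^sup>2 = (\<Sum>i\<in>J. (?r i)\<^sup>2)"
    using euclid_norm_stack_vecs_diff[of js f g] dims js by (simp add: sum_list_distinct_conv_sum_set)
  also have "\<dots> \<le> (\<Sum>i\<in>J. (?r j)\<^sup>2)"
    using max by (intro sum_mono power_mono) auto
  also have "\<dots> = (sqrt (real (card J)) * ?r j)\<^sup>2"
    by (simp add: power_mult_distrib)
  finally have "?s \<le> sqrt (real (card J)) * ?r j"
    by (rule power2_le_imp_le) simp
  then have "?s powr k \<le> (sqrt (real (card J)) * ?r j) powr k"
    using k by (intro powr_mono2) auto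
  also have "\<dots> = real (card J) powr (k / 2) * ?r j powr k"
    by (simp add: powr_mult powr_half_sqrt[symmetric] powr_powr)
  finally show ?thesis using j(1) by blast
qed

text \<open>The norm of a pair of blocks is at most that of the stacked state. To compare powers, \<open>r ^ e \<le> 1 + r ^ f\<close>
for \<open>e \<le> f\<close> and \<open>r \<ge> 0\<close>: the left-hand side is at most \<open>1\<close> or at most \<open>r ^ f\<close>.\<close>

lemma polynomial_growth_block_sum:
  assumes n: "n = (\<Sum>j<N. d j)" "n' = (\<Sum>j<N. d' j)"
    and V: "\<And>i. i < N \<Longrightarrow> polynomial_growth (d i) (d' i) (V i)"
  shows "polynomial_growth n n' (\<lambda>x x'. \<Sum>i<N. c i * V i (block d i x) (block d' i x'))"
proof -
  have "\<forall>i. \<exists>C e. i < N \<longrightarrow> (\<forall>x\<in>carrier_vec (d i). \<forall>x'\<in>carrier_vec (d' i).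
      \<bar>V i x x'\<bar> \<le> C * (1 + euclid_norm (x @\<^sub>v x') ^ e))"
    using V unfolding polynomial_growth_def by blast
  then obtain C e where Ce: "\<And>i x x'. i < N \<Longrightarrow> x \<in> carrier_vec (d i) \<Longrightarrow> x' \<in> carrier_vec (d' i) \<Longrightarrow>
      \<bar>V i x x'\<bar> \<le> C i * (1 + euclid_norm (x @\<^sub>v x') ^ e i)"
    by metis
  \<comment> \<open>The sum of the exponents serves as an upper bound of them. The factor \<open>2\<close> comes from
    \<open>1 + r ^ e i \<le> 1 + (1 + r ^ ?e)\<close>, which is at most \<open>2 * (1 + r ^ ?e)\<close>.\<close>
  let ?e = "\<Sum>i<N. e i" and ?C = "\<Sum>i<N. \<bar>c i\<bar> * (\<bar>C i\<bar> * 2)"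
  have "\<bar>\<Sum>i<N. c i * V i (block d i x) (block d' i x')\<bar> \<le> ?C * (1 + euclid_norm (x @\<^sub>v x') ^ ?e)"
    if x: "x \<in> carrier_vec n" "x' \<in> carrier_vec n'" for x x'
  proof -
    let ?r = "euclid_norm (x @\<^sub>v x')"
    have summand: "\<bar>c i * V i (block d i x) (block d' i x')\<bar> \<le> \<bar>c i\<bar> * (\<bar>C i\<bar> * 2) * (1 + ?r ^ ?e)"
      if i: "i < N" for i
    proof -
      let ?s = "euclid_norm (block d i x @\<^sub>v block d' i x')"
      have xx: "x @\<^sub>v x' \<in> carrier_vec (n + n')" using x by auto
      have s: "?s \<le> ?r"
        using euclid_norm_coords_le[OF pair_index(1,2)[OF i n] xx]
        unfolding pair_index(3)[OF i n x] .
      have "?s ^ e i \<le> 1 + ?r ^ ?e"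
      proof (cases "?r \<le> 1")
        case True
        then have "?s ^ e i \<le> 1" using s by (intro power_le_one) auto
        then show ?thesis by (simp add: add_increasing2)
      next
        case False
        have "?s ^ e i \<le> ?r ^ e i" using s by (intro power_mono) auto
        also have "\<dots> \<le> ?r ^ ?e"
          using False i by (intro power_increasing member_le_sum) auto
        finally show ?thesis by simp
      qed
      then have le2: "1 + ?s ^ e i \<le> 2 * (1 + ?r ^ ?e)"
        by (smt (verit) euclid_norm_nonneg zero_le_power)
      have "\<bar>V i (block d i x) (block d' i x')\<bar> \<le> C i * (1 + ?s ^ e i)"
        by (rule Ce[OF i]) auto
      also have "\<dots> \<le> \<bar>C i\<bar> * (1 + ?s ^ e i)"
        by (intro mult_right_mono) auto
      also have "\<dots> \<le> \<bar>C i\<bar> * (2 * (1 + ?r ^ ?e))"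
        by (rule mult_left_mono[OF le2]) simp
      finally show ?thesis
        by (simp add: abs_mult mult_left_mono mult.assoc)
    qed
    have "\<bar>\<Sum>i<N. c i * V i (block d i x) (block d' i x')\<bar>
        \<le> (\<Sum>i<N. \<bar>c i * V i (block d i x) (block d' i x')\<bar>)"
      by (rule sum_abs)
    also have "\<dots> \<le> (\<Sum>i<N. \<bar>c i\<bar> * (\<bar>C i\<bar> * 2) * (1 + ?r ^ ?e))"
      by (rule sum_mono) (simp only: lessThan_iff summand)
    finally show ?thesis by (simp only: sum_distrib_right)
  qed
  then show ?thesis unfolding polynomial_growth_def by blast
qed

section \<open>Small gain\<close>

lemma interconnection_simps [simp]:
  "state_dim (interconnection pt qt N q S) = (\<Sum>i<N. state_dim (S i))"
  "ext_dim (interconnection pt qt N q S) = (\<Sum>i<N. ext_dim (S i))"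
  "out_dim (interconnection pt qt N q S) = (\<Sum>i<N. q i i)"
  "diffusion (interconnection pt qt N q S) x
    = stack_mats pt (map (\<lambda>i. diffusion (S i) (block (\<lambda>i. state_dim (S i)) i x)) [0..<N])"
  "jump (interconnection pt qt N q S) x
    = stack_mats qt (map (\<lambda>i. jump (S i) (block (\<lambda>i. state_dim (S i)) i x)) [0..<N])"
  "out_map (interconnection pt qt N q S) x
    = stack_vecs (map (\<lambda>i. out_part q S i i (block (\<lambda>i. state_dim (S i)) i x)) [0..<N])"
  "closed_drift (interconnection pt qt N q S) x u = stack_vecs (map (\<lambda>i.
      drift (S i) (block (\<lambda>i. state_dim (S i)) i x) (block (\<lambda>i. ext_dim (S i)) i u)
        (internal_input N q S i x)) [0..<N])"
  by (simp_all add: interconnection_def Let_def)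

lemma out_part_carrier [simp]: "out_part q S i j x \<in> carrier_vec (q i j)"
  by (simp add: out_part_def)

lemma internal_input_carrier:
  assumes "partitioned N p q S" "i < N"
  shows "internal_input N q S i x \<in> carrier_vec (int_dim (S i))"
proof (rule carrier_vecI)
  have dim: "dim_vec (out_part q S j i y) = q j i" for j y by (simp add: out_part_def block_def)
  have "dim_vec (internal_input N q S i x) = (\<Sum>j\<leftarrow>filter (\<lambda>j. j \<noteq> i) [0..<N]. q j i)"
    by (simp add: internal_input_def dim_stack_vecs dim comp_def)
  also have "\<dots> = (\<Sum>j\<in>{..<N} - {i}. q j i)"
    by (subst sum_list_distinct_conv_sum_set) (auto intro!: sum.cong)
  also have "\<dots> = int_dim (S i)"
    using assms by (auto simp: partitioned_def intro!: sum.cong)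
  finally show "dim_vec (internal_input N q S i x) = int_dim (S i)" .
qed

lemma euclid_norm_out_part_diff_le:
  assumes "i < N" and "out_map (S j) x \<in> carrier_vec (\<Sum>i<N. q j i)"
    and "out_map (S' j) x' \<in> carrier_vec (\<Sum>i<N. q j i)"
  shows "euclid_norm (out_part q S j i x - out_part q S' j i x')
    \<le> euclid_norm (out_map (S j) x - out_map (S' j) x')"
proof -
  have "out_part q S j i x - out_part q S' j i x' = block (q j) i (out_map (S j) x - out_map (S' j) x')"
    unfolding out_part_def by (rule block_diff[OF assms(1,3), symmetric])
  then show ?thesis using euclid_norm_block_le[OF assms(1)] assms(2,3) by simp
qed

text \<open>The norm of the mismatch of the internal inputs is controlled by the mismatch coming from a single
subsystem \<open>j\<close>. If \<open>j\<close> does not act on \<open>i\<close>, this mismatch is \<open>0\<close>, as the same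
holds for the abstractions; otherwise it is at most the mismatch of the whole outputs of \<open>j\<close>, to which the
output bound \<open>\<alpha> j\<close> applies. The remaining terms \<open>G j\<close> of the right-hand side are nonnegative.\<close>

lemma internal_gain_le:
  fixes S S' :: "nat \<Rightarrow> 'w system"
  assumes i: "i < N" and k: "0 < k"
    and parts: "\<And>j. j < N \<Longrightarrow> out_map (S j) (block (\<lambda>l. state_dim (S l)) j x) \<in> carrier_vec (\<Sum>i<N. q j i)"
      "\<And>j. j < N \<Longrightarrow> out_map (S' j) (block (\<lambda>l. state_dim (S' l)) j x') \<in> carrier_vec (\<Sum>i<N. q j i)"
    and zero: "\<And>j. j < N \<Longrightarrow> j \<noteq> i \<Longrightarrow> out_part_zero q S j i \<Longrightarrow> out_part_zero q S' j i"
    and \<rho>: "class_Kinf \<rho>" and \<alpha>: "\<And>j. j < N \<Longrightarrow> class_Kinf (\<alpha> j)"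
    and \<alpha>_le: "\<And>j. j < N \<Longrightarrow> \<alpha> j (euclid_norm (out_map (S j) (block (\<lambda>l. state_dim (S l)) j x)
        - out_map (S' j) (block (\<lambda>l. state_dim (S' l)) j x')) powr k) \<le> v j"
    and v: "\<And>j. j < N \<Longrightarrow> 0 \<le> v j"
    and G: "\<And>j. j < N \<Longrightarrow> 0 \<le> G j"
    and gain: "\<And>j. j < N \<Longrightarrow> j \<noteq> i \<Longrightarrow> \<not> out_part_zero q S j i \<Longrightarrow>
      \<rho> ((real N - 1) powr max (k / 2) 1 * inv_into {0..} (\<alpha> j) (v j)) \<le> G j"
  shows "\<rho> (euclid_norm (internal_input N q S i x - internal_input N q S' i x') powr k)
    \<le> (\<Sum>j\<in>{..<N} - {i}. G j)"
proof -
  let ?w = "\<lambda>j. out_part q S j i (block (\<lambda>l. state_dim (S l)) j x)"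
  let ?w' = "\<lambda>j. out_part q S' j i (block (\<lambda>l. state_dim (S' l)) j x')"
  let ?js = "filter (\<lambda>j. j \<noteq> i) [0..<N]" and ?J = "{..<N} - {i}"
  let ?s = "euclid_norm (internal_input N q S i x - internal_input N q S' i x')"
  have G0: "0 \<le> (\<Sum>j\<in>?J. G j)" using G by (intro sum_nonneg) auto
  show ?thesis
  proof (cases "?J = {}")
    case True
    then have "?js = []" by (auto simp: filter_empty_conv)
    then have "?s = 0" by (simp add: internal_input_def stack_vecs_def euclid_norm_def)
    then show ?thesis using \<rho> G0 k by simp
  next
    case False
    have js: "distinct ?js" "set ?js = ?J" by auto
    have dims: "dim_vec (?w j) = dim_vec (?w' j)" for j
      by (simp add: out_part_def block_def)
    obtain j where j: "j \<in> ?J"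
      and le: "?s powr k \<le> real (card ?J) powr (k / 2) * euclid_norm (?w j - ?w' j) powr k"
      using euclid_norm_stack_vecs_diff_le[of ?js ?J ?w ?w' k, OF js False dims less_imp_le[OF k]]
      unfolding internal_input_def by blast
    have jN: "j < N" "j \<noteq> i" using j by auto
    have card: "real (card ?J) = real N - 1" using i by (simp add: of_nat_diff)
    have N1: "1 \<le> real N - 1" using i jN by linarith
    have "\<rho> (?s powr k) \<le> G j"
    proof (cases "out_part_zero q S j i")
      case True
      then have "?w j - ?w' j = 0\<^sub>v (q j i)"
        using zero[OF jN] block_carrier[of "\<lambda>l. state_dim (S l)" j x]
          block_carrier[of "\<lambda>l. state_dim (S' l)" j x']
        by (auto simp: out_part_zero_def)
      then have "?s powr k \<le> 0" using le by (simp add: euclid_norm_def)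
      then show ?thesis using \<rho> G[OF jN(1)] by simp
    next
      case False
      let ?r = "euclid_norm (out_map (S j) (block (\<lambda>l. state_dim (S l)) j x)
          - out_map (S' j) (block (\<lambda>l. state_dim (S' l)) j x'))"
      have "euclid_norm (?w j - ?w' j) powr k \<le> ?r powr k"
        using k euclid_norm_out_part_diff_le[where S = S and S' = S' and q = q, OF i parts[OF jN(1)]]
        by (intro powr_mono2) auto
      also have "\<dots> \<le> inv_into {0..} (\<alpha> j) (v j)"
        using class_Kinf_le_inv_into[OF \<alpha>[OF jN(1)] v[OF jN(1)]] \<alpha>_le[OF jN(1)] by simp
      finally have "real (card ?J) powr (k / 2) * euclid_norm (?w j - ?w' j) powr k
          \<le> (real N - 1) powr max (k / 2) 1 * inv_into {0..} (\<alpha> j) (v j)"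
        unfolding card using N1 by (intro mult_mono powr_mono) auto
      then have "?s powr k \<le> (real N - 1) powr max (k / 2) 1 * inv_into {0..} (\<alpha> j) (v j)"
        using le by linarith
      then have "\<rho> (?s powr k) \<le> \<rho> ((real N - 1) powr max (k / 2) 1 * inv_into {0..} (\<alpha> j) (v j))"
        by (subst class_Kinf_le[OF \<rho>]) (auto intro: order_trans[OF powr_ge_zero])
      then show ?thesis using gain[OF jN False] by linarith
    qed
    also have "\<dots> \<le> (\<Sum>j\<in>?J. G j)"
      using j G by (intro member_le_sum) auto
    finally show ?thesis .
  qed
qed

text \<open>Exchanging the order of summation collects the terms with \<open>g j\<close>. Their coefficient on the right-hand side
is the negative of the \<open>j\<close>-th entry of \<open>\<mu>\<^sup>T(- \<Lambda> + \<Delta>)\<close>, where \<open>l\<close> is the diagonal of \<open>\<Lambda>\<close>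
and \<open>D\<close> gives the entries of \<open>\<Delta>\<close> off the diagonal.\<close>

lemma small_gain_sum_le:
  fixes N :: nat and \<mu> l \<eta> a g :: "nat \<Rightarrow> real"
  assumes \<eta>: "\<And>i. i < N \<Longrightarrow> l i * g i \<le> \<eta> i" and \<mu>: "\<And>i. i < N \<Longrightarrow> 0 \<le> \<mu> i"
  shows "(\<Sum>i<N. \<mu> i * (- \<eta> i + (\<Sum>j\<in>{..<N} - {i}. D i j * g j)))
    \<le> - (\<Sum>j<N. (\<mu> j * l j - (\<Sum>i\<in>{..<N} - {j}. \<mu> i * D i j)) * g j)"
proof -
  let ?D = "\<lambda>i j. if i = j then 0 else D i j"
  have off_diag: "(\<Sum>j\<in>{..<N} - {i}. f j) = (\<Sum>j<N. if i = j then 0 else f j)" for f :: "nat \<Rightarrow> real" and i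
    by (rule sum.mono_neutral_cong_left) auto
  have column: "(\<Sum>i<N. \<mu> i * ?D i j) = (\<Sum>i\<in>{..<N} - {j}. \<mu> i * D i j)" for j
    unfolding off_diag by (intro sum.cong) auto
  have "(\<Sum>i<N. \<mu> i * (- \<eta> i + (\<Sum>j\<in>{..<N} - {i}. D i j * g j)))
      \<le> (\<Sum>i<N. \<mu> i * (- (l i * g i) + (\<Sum>j\<in>{..<N} - {i}. D i j * g j)))"
    using \<eta> \<mu> by (intro sum_mono mult_left_mono) auto
  also have "\<dots> = - (\<Sum>j<N. \<mu> j * l j * g j) + (\<Sum>i<N. \<Sum>j<N. \<mu> i * ?D i j * g j)"
  proof -
    have "\<mu> i * (- (l i * g i) + (\<Sum>j\<in>{..<N} - {i}. D i j * g j))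
        = - (\<mu> i * l i * g i) + (\<Sum>j<N. \<mu> i * ?D i j * g j)" for i
    proof -
      have "(\<Sum>j\<in>{..<N} - {i}. D i j * g j) = (\<Sum>j<N. ?D i j * g j)"
        unfolding off_diag by (intro sum.cong) auto
      then show ?thesis
        by (simp only: distrib_left sum_distrib_left mult.assoc mult_minus_right)
    qed
    then show ?thesis by (simp only: sum.distrib sum_negf)
  qed
  also have "(\<Sum>i<N. \<Sum>j<N. \<mu> i * ?D i j * g j) = (\<Sum>j<N. \<Sum>i<N. \<mu> i * ?D i j * g j)"
    by (rule sum.swap)
  also have "- (\<Sum>j<N. \<mu> j * l j * g j) + \<dots>
      = - (\<Sum>j<N. (\<mu> j * l j - (\<Sum>i<N. \<mu> i * ?D i j)) * g j)"
    by (simp add: left_diff_distrib sum_subtractf sum_distrib_right)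
  finally show ?thesis by (simp only: column)
qed

theorem theorem4p2:
  fixes M :: "'w measure" and F :: "real \<Rightarrow> 'w measure"
    and pt qt :: nat and W P :: "real \<Rightarrow> 'w \<Rightarrow> rvec" and lam :: "nat \<Rightarrow> real"
    and k :: real and N :: nat and p q :: "nat \<Rightarrow> nat \<Rightarrow> nat"
    and S S' :: "nat \<Rightarrow> 'w system"
    and V :: "nat \<Rightarrow> rvec \<Rightarrow> rvec \<Rightarrow> real"
    and \<alpha> \<eta> \<rho>ext \<rho>int \<gamma> :: "nat \<Rightarrow> real \<Rightarrow> real"
    and tlam :: "nat \<Rightarrow> real" and \<delta> :: "nat \<Rightarrow> nat \<Rightarrow> real"
    and \<Lambda> \<Delta> :: rmat and \<mu> :: rvec
  assumes noise: "noise M F pt W qt P lam"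
    and k: "k \<ge> 1" and N: "N \<ge> 1"
    and subsystems: "\<And>i. i < N \<Longrightarrow> stochastic_hybrid_system M F pt qt (S i)"
    and abstractions: "\<And>i. i < N \<Longrightarrow> stochastic_hybrid_system M F pt qt (S' i)"
    and same_int_inputs: "\<And>i. i < N \<Longrightarrow> int_inputs (S' i) = int_inputs (S i)"
    and partition: "partitioned N p q S"
    and abstract_partition: "partitioned N p q S'"
    and abstract_connections:
      "\<And>i j. i < N \<Longrightarrow> j < N \<Longrightarrow> i \<noteq> j \<Longrightarrow> out_part_zero q S i j \<Longrightarrow> out_part_zero q S' i j"
    and simulation_functions: "\<And>i. i < N \<Longrightarrow>
      SSF_M_with qt lam k (S' i) (S i) (V i) (\<alpha> i) (\<eta> i) (\<rho>ext i) (\<rho>int i)"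
    and \<gamma>: "\<And>i. i < N \<Longrightarrow> class_Kinf (\<gamma> i) \<and> convex_on {0..} (\<gamma> i)"
    and tlam_pos: "\<And>i. i < N \<Longrightarrow> tlam i > 0"
    and \<delta>_nonneg: "\<And>i j. i < N \<Longrightarrow> j < N \<Longrightarrow> i \<noteq> j \<Longrightarrow> \<delta> i j \<ge> 0"
    and a: "\<And>i j s. i < N \<Longrightarrow> j < N \<Longrightarrow> i \<noteq> j \<Longrightarrow> s \<ge> 0 \<Longrightarrow>
      \<eta> i s \<ge> tlam i * \<gamma> i s"
    and b: "\<And>i j. i < N \<Longrightarrow> j < N \<Longrightarrow> i \<noteq> j \<Longrightarrow> out_part_zero q S j i \<Longrightarrow> \<delta> i j = 0"
    and c: "\<And>i j s. i < N \<Longrightarrow> j < N \<Longrightarrow> i \<noteq> j \<Longrightarrow> s \<ge> 0 \<Longrightarrow> \<not> out_part_zero q S j i \<Longrightarrow>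
      \<rho>int i ((real N - 1) powr max (k / 2) 1 * inv_into {0..} (\<alpha> j) s) \<le> \<delta> i j * \<gamma> j s"
    and \<Lambda>: "\<Lambda> = Matrix.mat N N (\<lambda>(i, j). if i = j then tlam i else 0)"
    and \<Delta>: "\<Delta> = Matrix.mat N N (\<lambda>(i, j). if i = j then 0 else \<delta> i j)"
    and \<mu>: "\<mu> \<in> carrier_vec N" "\<And>i. i < N \<Longrightarrow> \<mu> $ i > 0"
    and small_gain: "\<And>j. j < N \<Longrightarrow> (mat_of_row \<mu> * (- \<Lambda> + \<Delta>)) $$ (0, j) < 0"
  shows "closed_SSF_M qt lam k (interconnection pt qt N q S') (interconnection pt qt N q S)
    (\<lambda>x x'. \<Sum>i<N. \<mu> $ i *
      V i (block (\<lambda>j. state_dim (S j)) i x) (block (\<lambda>j. state_dim (S' j)) i x'))"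
proof -
  define n n' m m' where "n = (\<lambda>i. state_dim (S i))" and "n' = (\<lambda>i. state_dim (S' i))"
    and "m = (\<lambda>i. ext_dim (S i))" and "m' = (\<lambda>i. ext_dim (S' i))"
  define I I' where "I = interconnection pt qt N q S" and "I' = interconnection pt qt N q S'"
  define U where "U = (\<lambda>x x'. \<Sum>i<N. \<mu> $ i * V i (block n i x) (block n' i x'))"
  have dims: "state_dim I = (\<Sum>i<N. n i)" "state_dim I' = (\<Sum>i<N. n' i)"
    "ext_dim I = (\<Sum>i<N. m i)" "ext_dim I' = (\<Sum>i<N. m' i)"
    by (simp_all add: I_def I'_def n_def n'_def m_def m'_def)
  have k0: "0 < k" using k by simp

  have sim: "C2_Rn (n i + n' i) (on_stacked (n i) (n' i) (V i))"
    "\<And>x x'. x \<in> carrier_vec (n i) \<Longrightarrow> x' \<in> carrier_vec (n' i) \<Longrightarrow> 0 \<le> V i x x'"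
    "polynomial_growth (n i) (n' i) (V i)"
    "class_Kinf (\<alpha> i)" "convex_on {0..} (\<alpha> i)" "class_Kinf (\<eta> i)" "convex_on {0..} (\<eta> i)"
    "class_Kinf (\<rho>ext i)" "concave_on {0..} (\<rho>ext i)" "class_Kinf (\<rho>int i)"
    "\<And>x x'. x \<in> carrier_vec (n i) \<Longrightarrow> x' \<in> carrier_vec (n' i) \<Longrightarrow>
      \<alpha> i (euclid_norm (out_map (S i) x - out_map (S' i) x') powr k) \<le> V i x x'"
    and int_dim: "int_dim (S' i) = int_dim (S i)"
    and dissipation: "\<And>x x' u' w'. x \<in> carrier_vec (n i) \<Longrightarrow> x' \<in> carrier_vec (n' i) \<Longrightarrow>
      u' \<in> carrier_vec (m' i) \<Longrightarrow> w' \<in> carrier_vec (int_dim (S i)) \<Longrightarrow>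
      \<exists>u\<in>carrier_vec (m i). \<forall>w\<in>carrier_vec (int_dim (S i)).
        generator qt lam (S i) (S' i) (V i) (drift (S i) x u w) (drift (S' i) x' u' w') x x'
          \<le> - \<eta> i (V i x x') + \<rho>ext i (euclid_norm u' powr k)
            + \<rho>int i (euclid_norm (w - w') powr k)"
    if "i < N" for i
    using simulation_functions[OF that]
    unfolding SSF_M_with_def SSF_common_def n_def n'_def m_def m'_def by blast+
  have sys: "x \<in> carrier_vec (n i) \<Longrightarrow> u \<in> carrier_vec (m i) \<Longrightarrow> w \<in> carrier_vec (int_dim (S i)) \<Longrightarrow>
      drift (S i) x u w \<in> carrier_vec (n i)"
    "x \<in> carrier_vec (n i) \<Longrightarrow> diffusion (S i) x \<in> carrier_mat (n i) pt"
    "x \<in> carrier_vec (n i) \<Longrightarrow> jump (S i) x \<in> carrier_mat (n i) qt"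
    "x \<in> carrier_vec (n i) \<Longrightarrow> out_map (S i) x \<in> carrier_vec (\<Sum>j<N. q i j)"
    if "i < N" for i x u w
    using subsystems[OF that] partition that
    unfolding stochastic_hybrid_system_def partitioned_def n_def m_def by auto
  have sys': "x \<in> carrier_vec (n' i) \<Longrightarrow> u \<in> carrier_vec (m' i) \<Longrightarrow> w \<in> carrier_vec (int_dim (S' i)) \<Longrightarrow>
      drift (S' i) x u w \<in> carrier_vec (n' i)"
    "x \<in> carrier_vec (n' i) \<Longrightarrow> diffusion (S' i) x \<in> carrier_mat (n' i) pt"
    "x \<in> carrier_vec (n' i) \<Longrightarrow> jump (S' i) x \<in> carrier_mat (n' i) qt"
    "x \<in> carrier_vec (n' i) \<Longrightarrow> out_map (S' i) x \<in> carrier_vec (\<Sum>j<N. q i j)"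
    if "i < N" for i x u w
    using abstractions[OF that] abstract_partition that
    unfolding stochastic_hybrid_system_def partitioned_def n'_def m'_def by auto

  have blk: "block n i x \<in> carrier_vec (n i)" "block n' i x \<in> carrier_vec (n' i)" for i x
    by simp_all
  have block_V: "0 \<le> V i (block n i x) (block n' i x')" if "i < N" for i x x'
    using sim(2)[OF that] by simp
  have U_ge: "\<mu> $ i * V i (block n i x) (block n' i x') \<le> U x x'" if "i < N" for i x x'
    unfolding U_def using that block_V \<mu>(2)
    by (intro member_le_sum) (auto intro!: mult_nonneg_nonneg simp: less_imp_le)

  obtain \<beta> where \<beta>: "class_Kinf \<beta>" "convex_on {0..} \<beta>"
    and \<beta>_le: "\<And>i t r. i < N \<Longrightarrow> 0 \<le> t \<Longrightarrow> 0 \<le> r \<Longrightarrow> t \<le> real N powr (k / 2) * r \<Longrightarrow>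
      \<beta> t \<le> \<mu> $ i * \<alpha> i r"
  proof (rule convex_common_lower_bound[OF N, of \<alpha> "\<lambda>i. \<mu> $ i" "real N powr (k / 2)"])
    show "0 < real N powr (k / 2)" using N by simp
  qed (use sim(4,5) \<mu>(2) in auto)
  have output_le: "\<beta> (euclid_norm (out_map I x - out_map I' x') powr k) \<le> U x x'" for x x'
  proof -
    let ?y = "\<lambda>i. out_part q S i i (block n i x)" and ?y' = "\<lambda>i. out_part q S' i i (block n' i x')"
    have all: "distinct [0..<N]" "set [0..<N] = {..<N}" "{..<N} \<noteq> {}"
      using N by (auto simp: lessThan_empty_iff)
    have y: "dim_vec (?y i) = dim_vec (?y' i)" for i by (simp add: out_part_def block_def)
    obtain i where i: "i < N"
      and le: "euclid_norm (out_map I x - out_map I' x') powr k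
        \<le> real N powr (k / 2) * euclid_norm (?y i - ?y' i) powr k"
      using euclid_norm_stack_vecs_diff_le[of "[0..<N]" "{..<N}" ?y ?y' k, OF all y less_imp_le[OF k0]]
      unfolding I_def I'_def interconnection_simps n_def[symmetric] n'_def[symmetric] card_lessThan
      by blast
    let ?r = "euclid_norm (out_map (S i) (block n i x) - out_map (S' i) (block n' i x'))"
    have "euclid_norm (?y i - ?y' i) powr k \<le> ?r powr k"
      using k0 euclid_norm_out_part_diff_le[where S = S and S' = S' and q = q, OF i sys(4)[OF i] sys'(4)[OF i]]
      by (intro powr_mono2) auto
    then have "euclid_norm (out_map I x - out_map I' x') powr k \<le> real N powr (k / 2) * ?r powr k"
      by (intro order_trans[OF le] mult_left_mono) auto
    then have "\<beta> (euclid_norm (out_map I x - out_map I' x') powr k) \<le> \<mu> $ i * \<alpha> i (?r powr k)"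
      by (intro \<beta>_le[OF i]) auto
    also have "\<dots> \<le> \<mu> $ i * V i (block n i x) (block n' i x')"
      using \<mu>(2)[OF i] sim(11)[OF i] by (intro mult_left_mono) auto
    finally show ?thesis using U_ge[OF i] by (rule order_trans)
  qed

  \<comment> \<open>For a single subsystem there are no indices \<open>i \<noteq> j\<close>, so nothing relates \<open>\<eta> i\<close> to \<open>\<gamma> i\<close>. A
    multiple of \<open>\<eta> i\<close> then takes the place of \<open>\<gamma> i\<close>. The factor \<open>1\<close> of \<open>s\<close> gives
    the function the shape of the rescaling lemmas.\<close>
  define \<Gamma> where "\<Gamma> = (\<lambda>i. if N = 1 then (\<lambda>s. 1 / tlam i * \<eta> i (1 * s)) else \<gamma> i)"
  have \<Gamma>: "class_Kinf (\<Gamma> i)" "convex_on {0..} (\<Gamma> i)" "\<And>s. 0 \<le> s \<Longrightarrow> tlam i * \<Gamma> i s \<le> \<eta> i s"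
    if i: "i < N" for i
  proof -
    have pos: "0 < 1 / tlam i" using tlam_pos[OF i] by simp
    show "class_Kinf (\<Gamma> i)"
      using class_Kinf_rescale[OF sim(6)[OF i] pos, of 1] \<gamma>[OF i]
      unfolding \<Gamma>_def by (cases "N = 1") simp_all
    show "convex_on {0..} (\<Gamma> i)"
      using convex_on_rescale[OF sim(7)[OF i] less_imp_le[OF pos], of 1] \<gamma>[OF i]
      unfolding \<Gamma>_def by (cases "N = 1") simp_all
    show "tlam i * \<Gamma> i s \<le> \<eta> i s" if s: "0 \<le> s" for s
    proof (cases "N = 1")
      case True
      then show ?thesis using tlam_pos[OF i] by (simp add: \<Gamma>_def)
    next
      case False
      obtain j where "j < N" "j \<noteq> i"
        using that[of 0] that[of 1] i N False by (cases "i = 0") auto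
      then show ?thesis using a[OF i _ _ s, of j] False by (auto simp: \<Gamma>_def)
    qed
  qed

  define \<epsilon> where "\<epsilon> = (\<lambda>j. \<mu> $ j * tlam j - (\<Sum>i\<in>{..<N} - {j}. \<mu> $ i * \<delta> i j))"
  have \<epsilon>: "0 < \<epsilon> j" if j: "j < N" for j
  proof -
    have "(mat_of_row \<mu> * (- \<Lambda> + \<Delta>)) $$ (0, j) = (\<Sum>i<N. \<mu> $ i * (if i = j then - tlam i else \<delta> i j))"
    proof -
      have M: "- \<Lambda> + \<Delta> = Matrix.mat N N (\<lambda>(i, j). if i = j then - tlam i else \<delta> i j)"
        unfolding \<Lambda> \<Delta> by (intro eq_matI) auto
      have "(mat_of_row \<mu> * (- \<Lambda> + \<Delta>)) $$ (0, j) = row (mat_of_row \<mu>) 0 \<bullet> col (- \<Lambda> + \<Delta>) j"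
        using j unfolding M by (intro index_mult_mat(1)) auto
      then show ?thesis
        using j \<mu>(1) unfolding M by (auto simp: scalar_prod_def atLeast0LessThan intro!: sum.cong)
    qed
    also have "\<dots> = - \<epsilon> j"
      using j by (subst sum.remove[of _ j]) (auto simp: \<epsilon>_def intro!: sum.cong)
    finally show ?thesis using small_gain[OF j] by simp
  qed
  obtain \<kappa> where \<kappa>: "class_Kinf \<kappa>" "convex_on {0..} \<kappa>"
    and \<kappa>_le: "\<forall>a. (\<forall>i<N. 0 \<le> a i) \<longrightarrow> \<kappa> (\<Sum>i<N. \<mu> $ i * a i) \<le> (\<Sum>i<N. \<epsilon> i * \<Gamma> i (a i))"
    using convex_rate_of_weighted_sum[of N \<Gamma> \<epsilon> "\<lambda>i. \<mu> $ i", OF N \<Gamma>(1,2) \<epsilon> \<mu>(2)] by blast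

  define \<rho> where "\<rho> = (\<lambda>s. \<Sum>i<N. \<mu> $ i * \<rho>ext i s)"
  have \<rho>: "class_Kinf \<rho>" "concave_on {0..} \<rho>"
    using concave_class_Kinf_weighted_sum[where \<mu> = "\<lambda>i. \<mu> $ i", OF N sim(8,9) \<mu>(2)]
    by (simp_all add: \<rho>_def)

  have decay: "\<exists>u\<in>carrier_vec (ext_dim I). generator qt lam I I' U (closed_drift I x u) (closed_drift I' x' u') x x'
      \<le> - \<kappa> (U x x') + \<rho> (euclid_norm u' powr k)"
    if x: "x \<in> carrier_vec (state_dim I)" and x': "x' \<in> carrier_vec (state_dim I')"
      and u': "u' \<in> carrier_vec (ext_dim I')" for x x' u'
  proof -
    let ?x = "\<lambda>i. block n i x" and ?x' = "\<lambda>i. block n' i x'" and ?u' = "\<lambda>i. block m' i u'"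
    let ?w = "\<lambda>i. internal_input N q S i x" and ?w' = "\<lambda>i. internal_input N q S' i x'"
    let ?v = "\<lambda>i. V i (?x i) (?x' i)"
    have w: "?w i \<in> carrier_vec (int_dim (S i))" "?w' i \<in> carrier_vec (int_dim (S' i))"
      "?w' i \<in> carrier_vec (int_dim (S i))" if "i < N" for i
      using internal_input_carrier[OF partition that] internal_input_carrier[OF abstract_partition that]
        int_dim[OF that] by auto
    \<comment> \<open>The input \<open>u\<close> may depend on the abstract internal input, which is determined by \<open>x'\<close>, but it has to
      serve all concrete internal inputs; it is used for the one that \<open>x\<close> generates.\<close>
    have "\<exists>u\<in>carrier_vec (m i). \<forall>w\<in>carrier_vec (int_dim (S i)).
        generator qt lam (S i) (S' i) (V i) (drift (S i) (?x i) u w) (drift (S' i) (?x' i) (?u' i) (?w' i)) (?x i) (?x' i)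
          \<le> - \<eta> i (?v i) + \<rho>ext i (euclid_norm (?u' i) powr k) + \<rho>int i (euclid_norm (w - ?w' i) powr k)"
      if "i < N" for i
      by (rule dissipation[OF that _ _ _ w(3)[OF that]]) simp_all
    then have "\<forall>i. \<exists>u. i < N \<longrightarrow> u \<in> carrier_vec (m i) \<and>
        generator qt lam (S i) (S' i) (V i) (drift (S i) (?x i) u (?w i)) (drift (S' i) (?x' i) (?u' i) (?w' i)) (?x i) (?x' i)
          \<le> - \<eta> i (?v i) + \<rho>ext i (euclid_norm (?u' i) powr k) + \<rho>int i (euclid_norm (?w i - ?w' i) powr k)"
      using w(1) by blast
    then obtain us where us: "\<And>i. i < N \<Longrightarrow> us i \<in> carrier_vec (m i)"
      and gen_i: "\<And>i. i < N \<Longrightarrow>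
        generator qt lam (S i) (S' i) (V i) (drift (S i) (?x i) (us i) (?w i)) (drift (S' i) (?x' i) (?u' i) (?w' i)) (?x i) (?x' i)
          \<le> - \<eta> i (?v i) + \<rho>ext i (euclid_norm (?u' i) powr k) + \<rho>int i (euclid_norm (?w i - ?w' i) powr k)"
      using choice by metis
    define u where "u = stack_vecs (map us [0..<N])"
    have u: "u \<in> carrier_vec (ext_dim I)"
      unfolding dims u_def by (rule stack_vecs_carrier[OF us])
    let ?b = "\<lambda>i. drift (S i) (?x i) (us i) (?w i)" and ?b' = "\<lambda>i. drift (S' i) (?x' i) (?u' i) (?w' i)"
    have b: "?b i \<in> carrier_vec (n i)" "?b' i \<in> carrier_vec (n' i)" if "i < N" for i
      using sys(1)[OF that _ us[OF that] w(1)[OF that]] sys'(1)[OF that _ _ w(2)[OF that]] by auto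
    have block_u: "block m i u = us i" if "i < N" for i
      unfolding u_def by (rule block_stack_vecs[OF us that])
    have drift: "closed_drift I x u = stack_vecs (map ?b [0..<N])"
      "closed_drift I' x' u' = stack_vecs (map ?b' [0..<N])"
      unfolding I_def I'_def interconnection_simps n_def[symmetric] n'_def[symmetric] m_def[symmetric] m'_def[symmetric]
      using block_u by (auto intro!: arg_cong[where f = stack_vecs])
    have block_b: "block n i (closed_drift I x u) = ?b i" "block n' i (closed_drift I' x' u') = ?b' i"
      if "i < N" for i
      unfolding drift using block_stack_vecs[where d = n, OF b(1) that]
        block_stack_vecs[where d = n', OF b(2) that] by auto
    have carrier_b: "closed_drift I x u \<in> carrier_vec (\<Sum>i<N. n i)"
      "closed_drift I' x' u' \<in> carrier_vec (\<Sum>i<N. n' i)"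
      unfolding drift using stack_vecs_carrier[of N ?b n, OF b(1)] stack_vecs_carrier[of N ?b' n', OF b(2)]
      by auto
    have "generator qt lam I I' U (closed_drift I x u) (closed_drift I' x' u') x x'
        = (\<Sum>i<N. \<mu> $ i * generator qt lam (S i) (S' i) (V i) (block n i (closed_drift I x u))
            (block n' i (closed_drift I' x' u')) (?x i) (?x' i))"
      unfolding U_def n_def n'_def
      by (rule generator_block_sum)
        (use dims x x' carrier_b sim(1) sys(2,3)[OF _ blk(1)] sys'(2,3)[OF _ blk(2)]
          in \<open>simp_all add: n_def n'_def I_def I'_def\<close>)
    also have "\<dots> = (\<Sum>i<N. \<mu> $ i * generator qt lam (S i) (S' i) (V i) (?b i) (?b' i) (?x i) (?x' i))"
      by (intro sum.cong) (auto simp: block_b)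
    also have "\<dots> \<le> (\<Sum>i<N. \<mu> $ i * ((- \<eta> i (?v i) + (\<Sum>j\<in>{..<N} - {i}. \<delta> i j * \<Gamma> j (?v j)))
        + \<rho>ext i (euclid_norm u' powr k)))"
    proof (intro sum_mono mult_left_mono)
      fix i assume "i \<in> {..<N}"
      then have i: "i < N" by simp
      show "0 \<le> \<mu> $ i" using \<mu>(2)[OF i] by simp
      have "euclid_norm (?u' i) powr k \<le> euclid_norm u' powr k"
        using u' k0 euclid_norm_block_le[OF i, of u' m'] by (intro powr_mono2) (auto simp: dims)
      then have ext: "\<rho>ext i (euclid_norm (?u' i) powr k) \<le> \<rho>ext i (euclid_norm u' powr k)"
        by (subst class_Kinf_le[OF sim(8)[OF i]]) auto
      have int: "\<rho>int i (euclid_norm (?w i - ?w' i) powr k)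
          \<le> (\<Sum>j\<in>{..<N} - {i}. \<delta> i j * \<Gamma> j (?v j))"
      proof -
        \<comment> \<open>The diagonal entry \<open>\<delta> i i\<close> is arbitrary and may be negative; \<open>0\<close> takes its place.\<close>
        let ?G = "\<lambda>j. (if j = i then 0 else \<delta> i j) * \<Gamma> j (?v j)"
        have "\<rho>int i (euclid_norm (?w i - ?w' i) powr k) \<le> (\<Sum>j\<in>{..<N} - {i}. ?G j)"
        proof (rule internal_gain_le[OF i k0, where \<alpha> = \<alpha> and v = ?v])
          fix j assume j: "j < N"
          show "out_map (S j) (block (\<lambda>l. state_dim (S l)) j x) \<in> carrier_vec (\<Sum>i<N. q j i)"
            using sys(4)[OF j blk(1), of x] by (simp add: n_def)
          show "out_map (S' j) (block (\<lambda>l. state_dim (S' l)) j x') \<in> carrier_vec (\<Sum>i<N. q j i)"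
            using sys'(4)[OF j blk(2), of x'] by (simp add: n'_def)
          show "class_Kinf (\<alpha> j)" by (rule sim(4)[OF j])
          show "0 \<le> ?v j" by (rule block_V[OF j])
          show "0 \<le> ?G j" using \<delta>_nonneg[OF i j] class_Kinf_nonneg[OF \<Gamma>(1)[OF j] block_V[OF j]] by simp
          show "\<alpha> j (euclid_norm (out_map (S j) (block (\<lambda>l. state_dim (S l)) j x)
              - out_map (S' j) (block (\<lambda>l. state_dim (S' l)) j x')) powr k) \<le> ?v j"
            using sim(11)[OF j blk, of x x'] by (simp add: n_def n'_def)
          assume ji: "j \<noteq> i"
          show "out_part_zero q S' j i" if "out_part_zero q S j i"
            by (rule abstract_connections[OF j i ji that])
          have "\<Gamma> j = \<gamma> j" using i j ji by (auto simp: \<Gamma>_def fun_eq_iff)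
          then show "\<rho>int i ((real N - 1) powr max (k / 2) 1 * inv_into {0..} (\<alpha> j) (?v j)) \<le> ?G j"
            if "\<not> out_part_zero q S j i"
            using c[OF i j _ block_V[OF j] that] ji by auto
        next
          show "class_Kinf (\<rho>int i)" by (rule sim(10)[OF i])
        qed
        also have "\<dots> = (\<Sum>j\<in>{..<N} - {i}. \<delta> i j * \<Gamma> j (?v j))"
          by (intro sum.cong) auto
        finally show ?thesis .
      qed
      show "generator qt lam (S i) (S' i) (V i) (?b i) (?b' i) (?x i) (?x' i)
          \<le> (- \<eta> i (?v i) + (\<Sum>j\<in>{..<N} - {i}. \<delta> i j * \<Gamma> j (?v j))) + \<rho>ext i (euclid_norm u' powr k)"
        using gen_i[OF i] ext int by linarith
    qed
    also have "\<dots> = (\<Sum>i<N. \<mu> $ i * (- \<eta> i (?v i) + (\<Sum>j\<in>{..<N} - {i}. \<delta> i j * \<Gamma> j (?v j))))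
        + \<rho> (euclid_norm u' powr k)"
      unfolding \<rho>_def by (simp only: distrib_left[of _ _ "\<rho>ext _ _"] sum.distrib)
    also have "\<dots> \<le> - (\<Sum>j<N. \<epsilon> j * \<Gamma> j (?v j)) + \<rho> (euclid_norm u' powr k)"
      unfolding \<epsilon>_def using \<Gamma>(3) block_V \<mu>(2)
      by (intro add_right_mono small_gain_sum_le) (auto simp: less_imp_le)
    also have "\<dots> \<le> - \<kappa> (U x x') + \<rho> (euclid_norm u' powr k)"
      using \<kappa>_le[rule_format, of ?v] block_V by (simp add: U_def)
    finally show ?thesis using u by blast
  qed

  have "SSF_common k I' I U \<beta> \<kappa> \<rho>"
    unfolding SSF_common_def
  proof (intro conjI ballI)
    show "out_dim I' = out_dim I" by (simp add: I_def I'_def)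
    show "C2_Rn (state_dim I + state_dim I') (on_stacked (state_dim I) (state_dim I') U)"
      unfolding U_def by (rule C2_Rn_block_sum[OF dims(1,2) sim(1)])
    show "polynomial_growth (state_dim I) (state_dim I') U"
      unfolding U_def by (rule polynomial_growth_block_sum[OF dims(1,2) sim(3)])
    show "0 \<le> U x x'" for x x'
      unfolding U_def using block_V \<mu>(2) by (intro sum_nonneg mult_nonneg_nonneg) (auto simp: less_imp_le)
  qed (use \<beta> \<kappa> \<rho> output_le in auto)
  then show ?thesis
    unfolding closed_SSF_M_def using decay
    unfolding U_def I_def I'_def n_def n'_def by blast
qed

end
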